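(* Let $\pi'$ be a refinement of $\pi$. If $A\in\Sigma$, then $A'\in\Sigma'$ and $$p_{A'}=p_Ap_{\pi'}=p_{\pi'}p_A=p_A\wedge p_{\pi'}.$$ In particular $p_A$ and $p_{\pi'}$ commute and $\mathcal H_{A'}=\mathcal H_A\cap\mathcal H_{\pi'}$.
   Context: Let $\mathcal H$ be a complex Hilbert space. A projection is a bounded self-adjoint idempotent operator; $p\wedge q$ (and $\wedge_\alpha p_\alpha$) is the projection onto the intersection of ranges. For $\phi\neq0$, $\hat\phi=\phi/\|\phi\|$. Sums of countably many operators are understood strongly. A family $\rho=\{p^t_a:t\in T,\ a\in\Delta(t)\}$ of projections, with $T$ a set, each $\Delta(t)$ countable and $\sum_{a\in\Delta(t)}p^t_a=I$ for each $t$, determines: $p^{t_1,\dots,t_k}_{a_1,\dots,a_k}=\wedge_ip^{t_i}_{a_i}$; $\mathcal H_\rho$ = the closed subspace of $\phi$ on which $\rho$ commutes ($W\phi=V\phi$ whenever $W,V$ are finite products of elements of $\rho$ with the same factors, with multiplicity, in possibly different orders), with projection $p_\rho$; $\Omega_\rho=\prod_{t\in T}\Delta(t)$, $X_t(\omega)=\omega_t$, $\Sigma_\rho$ the σ-algebra generated by the sets $\{X_t=a\}$; for $\phi\in\mathcal H_\rho\setminus\{0\}$, $\mathbb P_\phi$ the unique probability measure on $(\Omega_\rho,\Sigma_\rho)$ with $\mathbb P_\phi(X_{t_i}=a_i,\ i\le k)=\|p^{t_1,\dots,t_k}_{a_1,\dots,a_k}\hat\phi\|^2$; and for $A\in\Sigma_\rho$,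 $\mathcal H_A=\{\phi\in\mathcal H_\rho:\phi=0\text{ or }\mathbb P_\phi(A)=1\}$ with projection $p_A$. Let $\pi=\{p^t_a:t\in S,a\in\Gamma(t)\}$ be such a family with $\Omega=\Omega_\pi$, $\Sigma=\Sigma_\pi$. A refinement of $\pi$ is such a family $\pi'=\{p^t_b:t\in S',\ b\in\Gamma'(t)\}$ (with associated $\Omega'$, $\Sigma'$, and $p_{A'}$, $\mathcal H_{A'}$ defined relative to $\pi'$) where $S\subset S'$ and, for each $t\in S$, $\Gamma'(t)$ is the disjoint union of sets $\Gamma'_a(t)$, $a\in\Gamma(t)$, with $p^t_a=\sum_{b\in\Gamma'_a(t)}p^t_b$. For $A\subset\Omega$, $A'=\{\omega'\in\Omega':$ for some $\omega\in A$, $\omega'(t)\in\Gamma'_{\omega(t)}(t)$ for all $t\in S\}$. *)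

theory Defs
  imports "HOL-Probability.Probability" "HOL-Library.Multiset"
begin

class complex_inner = real_normed_vector +
  fixes scaleC :: "complex \<Rightarrow> 'a \<Rightarrow> 'a"
    and cinner :: "'a \<Rightarrow> 'a \<Rightarrow> complex"
  assumes scaleC_add_right: "scaleC c (x + y) = scaleC c x + scaleC c y"
    and scaleC_add_left: "scaleC (c + d) x = scaleC c x + scaleC d x"
    and scaleC_scaleC: "scaleC c (scaleC d x) = scaleC (c * d) x"
    and scaleC_one: "scaleC 1 x = x"
    and scaleR_scaleC: "scaleR r x = scaleC (complex_of_real r) x"
    and cinner_commute: "cinner x y = cnj (cinner y x)"
    and cinner_add_left: "cinner (x + y) z = cinner x z + cinner y z"
    and cinner_scaleC_left: "cinner (scaleC c x) y = cnj c * cinner x y"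
    and cinner_self_real: "Im (cinner x x) = 0"
    and cinner_self_nonneg: "0 \<le> Re (cinner x x)"
    and cinner_self_eq_zero: "cinner x x = 0 \<longleftrightarrow> x = 0"
    and norm_eq_sqrt_cinner: "norm x = sqrt (Re (cinner x x))"

class chilbert_space = complex_inner + complete_space

definition is_proj :: "('h::complex_inner \<Rightarrow> 'h) \<Rightarrow> bool" where
  "is_proj P \<longleftrightarrow> bounded_linear P \<and> (\<forall>c x. P (scaleC c x) = scaleC c (P x))
     \<and> (\<forall>x y. cinner (P x) y = cinner x (P y)) \<and> (\<forall>x. P (P x) = P x)"

text \<open>The projection with range S (for a closed subspace S).\<close>
definition proj_onto :: "'h::complex_inner set \<Rightarrow> ('h \<Rightarrow> 'h)" where
  "proj_onto S = (THE P. is_proj P \<and> range P = S)"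

definition pmeet :: "('h::complex_inner \<Rightarrow> 'h) set \<Rightarrow> ('h \<Rightarrow> 'h)" where
  "pmeet Ps = proj_onto (\<Inter>P\<in>Ps. range P)"

definition proj_family :: "'t set \<Rightarrow> ('t \<Rightarrow> 'c set) \<Rightarrow> ('t \<Rightarrow> 'c \<Rightarrow> 'h::complex_inner \<Rightarrow> 'h) \<Rightarrow> bool" where
  "proj_family T \<Delta> p \<longleftrightarrow> (\<forall>t\<in>T. countable (\<Delta> t) \<and> (\<forall>a\<in>\<Delta> t. is_proj (p t a))
      \<and> (\<forall>\<phi>. ((\<lambda>a. p t a \<phi>) has_sum \<phi>) (\<Delta> t)))"

definition fam_ops :: "'t set \<Rightarrow> ('t \<Rightarrow> 'c set) \<Rightarrow> ('t \<Rightarrow> 'c \<Rightarrow> 'h \<Rightarrow> 'h) \<Rightarrow> ('h \<Rightarrow> 'h) set" where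
  "fam_ops T \<Delta> p = {p t a | t a. t \<in> T \<and> a \<in> \<Delta> t}"

definition oprod :: "('h \<Rightarrow> 'h) list \<Rightarrow> ('h \<Rightarrow> 'h)" where
  "oprod ws = foldr (\<circ>) ws id"

definition Hrho :: "'t set \<Rightarrow> ('t \<Rightarrow> 'c set) \<Rightarrow> ('t \<Rightarrow> 'c \<Rightarrow> 'h \<Rightarrow> 'h) \<Rightarrow> 'h set" where
  "Hrho T \<Delta> p = {\<phi>. \<forall>ws vs. set ws \<subseteq> fam_ops T \<Delta> p \<longrightarrow> set vs \<subseteq> fam_ops T \<Delta> p
        \<longrightarrow> mset ws = mset vs \<longrightarrow> oprod ws \<phi> = oprod vs \<phi>}"

definition prho :: "'t set \<Rightarrow> ('t \<Rightarrow> 'c set) \<Rightarrow> ('t \<Rightarrow> 'c \<Rightarrow> 'h::complex_inner \<Rightarrow> 'h) \<Rightarrow> ('h \<Rightarrow> 'h)" where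
  "prho T \<Delta> p = proj_onto (Hrho T \<Delta> p)"

definition Omega_rho :: "'t set \<Rightarrow> ('t \<Rightarrow> 'c set) \<Rightarrow> ('t \<Rightarrow> 'c) set" where
  "Omega_rho T \<Delta> = (\<Pi>\<^sub>E t\<in>T. \<Delta> t)"

definition Sigma_rho :: "'t set \<Rightarrow> ('t \<Rightarrow> 'c set) \<Rightarrow> ('t \<Rightarrow> 'c) set set" where
  "Sigma_rho T \<Delta> = sigma_sets (Omega_rho T \<Delta>)
      {{\<omega> \<in> Omega_rho T \<Delta>. \<omega> t = a} | t a. t \<in> T \<and> a \<in> \<Delta> t}"

definition cyl :: "'t set \<Rightarrow> ('t \<Rightarrow> 'c set) \<Rightarrow> ('t \<times> 'c) set \<Rightarrow> ('t \<Rightarrow> 'c) set" where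
  "cyl T \<Delta> F = {\<omega> \<in> Omega_rho T \<Delta>. \<forall>(t, a)\<in>F. \<omega> t = a}"

definition Pphi :: "'t set \<Rightarrow> ('t \<Rightarrow> 'c set) \<Rightarrow> ('t \<Rightarrow> 'c \<Rightarrow> 'h::complex_inner \<Rightarrow> 'h) \<Rightarrow> 'h \<Rightarrow> ('t \<Rightarrow> 'c) measure" where
  "Pphi T \<Delta> p \<phi> = (THE M. prob_space M \<and> space M = Omega_rho T \<Delta> \<and> sets M = Sigma_rho T \<Delta>
      \<and> (\<forall>F. finite F \<and> F \<subseteq> Sigma T \<Delta> \<longrightarrow>
           measure M (cyl T \<Delta> F) = (norm (pmeet ((\<lambda>(t, a). p t a) ` F) (scaleR (inverse (norm \<phi>)) \<phi>)))\<^sup>2))"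

definition HA :: "'t set \<Rightarrow> ('t \<Rightarrow> 'c set) \<Rightarrow> ('t \<Rightarrow> 'c \<Rightarrow> 'h::complex_inner \<Rightarrow> 'h) \<Rightarrow> ('t \<Rightarrow> 'c) set \<Rightarrow> 'h set" where
  "HA T \<Delta> p A = {\<phi> \<in> Hrho T \<Delta> p. \<phi> = 0 \<or> measure (Pphi T \<Delta> p \<phi>) A = 1}"

definition pA :: "'t set \<Rightarrow> ('t \<Rightarrow> 'c set) \<Rightarrow> ('t \<Rightarrow> 'c \<Rightarrow> 'h::complex_inner \<Rightarrow> 'h) \<Rightarrow> ('t \<Rightarrow> 'c) set \<Rightarrow> ('h \<Rightarrow> 'h)" where
  "pA T \<Delta> p A = proj_onto (HA T \<Delta> p A)"

text \<open>\<open>\<pi>' = (S', \<Gamma>', p')\<close> is a refinement of \<open>\<pi> = (S, \<Gamma>, p)\<close> via the decomposition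
\<open>g t a = \<Gamma>'_a(t)\<close>.\<close>
definition refinement ::
  "'t set \<Rightarrow> ('t \<Rightarrow> 'c set) \<Rightarrow> ('t \<Rightarrow> 'c \<Rightarrow> 'h::complex_inner \<Rightarrow> 'h) \<Rightarrow>
   't set \<Rightarrow> ('t \<Rightarrow> 'd set) \<Rightarrow> ('t \<Rightarrow> 'd \<Rightarrow> 'h \<Rightarrow> 'h) \<Rightarrow> ('t \<Rightarrow> 'c \<Rightarrow> 'd set) \<Rightarrow> bool" where
  "refinement S \<Gamma> p S' \<Gamma>' p' g \<longleftrightarrow> proj_family S' \<Gamma>' p' \<and> S \<subseteq> S' \<and>
     (\<forall>t\<in>S. \<Gamma>' t = (\<Union>a\<in>\<Gamma> t. g t a) \<and> disjoint_family_on (g t) (\<Gamma> t) \<and>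
        (\<forall>a\<in>\<Gamma> t. \<forall>\<phi>. ((\<lambda>b. p' t b \<phi>) has_sum p t a \<phi>) (g t a)))"

definition lift_set :: "'t set \<Rightarrow> 't set \<Rightarrow> ('t \<Rightarrow> 'd set) \<Rightarrow> ('t \<Rightarrow> 'c \<Rightarrow> 'd set) \<Rightarrow> ('t \<Rightarrow> 'c) set \<Rightarrow> ('t \<Rightarrow> 'd) set" where
  "lift_set S S' \<Gamma>' g A = {\<omega>' \<in> Omega_rho S' \<Gamma>'. \<exists>\<omega>\<in>A. \<forall>t\<in>S. \<omega>' t \<in> g t (\<omega> t)}"

end

theory Submission
  imports Defs
begin

text \<open>
  For \<open>\<phi> \<in> \<H>\<^sub>\<rho>\<close> put \<open>\<mu>\<^sub>\<phi> = \<parallel>\<phi>\<parallel>\<^sup>2 \<cdot> \<P>\<^sub>\<phi>\<close>. On cylinders \<open>\<mu>\<^sub>\<phi>\<close> is the squared norm of a linear image of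
  \<open>\<phi>\<close>, so by a Dynkin argument \<open>\<phi> \<mapsto> \<mu>\<^sub>\<phi>(A)\<close> obeys the (weighted) parallelogram law for every
  measurable \<open>A\<close>. Since \<open>\<H>\<^sub>A\<close> consists of the \<open>\<phi>\<close> with \<open>\<mu>\<^sub>\<phi>(\<Omega> - A) = 0\<close>, it is a closed subspace
  orthogonal to the one belonging to \<open>\<Omega> - A\<close>.

  On \<open>\<H>\<^sub>\<pi>\<^sub>'\<close> the coarse projections are strong sums of commuting fine ones, hence leave \<open>\<H>\<^sub>\<pi>\<^sub>'\<close> invariant
  and commute there, so \<open>\<H>\<^sub>\<pi>\<^sub>' \<subseteq> \<H>\<^sub>\<pi>\<close>. With \<open>L(A) = \<H>\<^sub>A \<inter> \<H>\<^sub>A\<^sub>'\<close>, the measurable sets \<open>A\<close> for which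
  \<open>\<H>\<^sub>\<pi>\<^sub>' = L(A) \<oplus> L(\<Omega> - A)\<close> contain the sets \<open>{X\<^sub>t = a}\<close> and form a \<open>\<sigma>\<close>-algebra, so they are all of
  \<open>\<Sigma>\<close>. Orthogonality then forces \<open>\<H>\<^sub>A \<inter> \<H>\<^sub>\<pi>\<^sub>' = L(A) = \<H>\<^sub>A\<^sub>'\<close>, and \<open>p\<^sub>A\<close> maps \<open>\<H>\<^sub>\<pi>\<^sub>'\<close> into itself, which
  makes \<open>p\<^sub>A\<close> commute with \<open>p\<^sub>\<pi>\<^sub>'\<close>.
\<close>

section \<open>Orthogonal projections\<close>

lemma cinner_add_right: "cinner x (y + z) = cinner x y + cinner x (z::'a::complex_inner)"
  by (metis cinner_add_left cinner_commute complex_cnj_add)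

lemma cinner_scaleC_right: "cinner x (scaleC c y) = c * cinner x (y::'a::complex_inner)"
  by (metis cinner_commute cinner_scaleC_left complex_cnj_cnj complex_cnj_mult)

lemma scaleC_minus1: "scaleC (- 1) x = - (x::'a::complex_inner)"
  using scaleR_scaleC[of "-1" x] by simp

lemma cinner_minus_left: "cinner (- x) y = - cinner x (y::'a::complex_inner)"
  using cinner_scaleC_left[of "-1" x y] by (simp add: scaleC_minus1)

lemma cinner_minus_right: "cinner x (- y) = - cinner x (y::'a::complex_inner)"
  using cinner_scaleC_right[of x "-1" y] by (simp add: scaleC_minus1)

lemma cinner_diff_left: "cinner (x - y) z = cinner x z - cinner y (z::'a::complex_inner)"
  using cinner_add_left[of x "-y" z] by (simp add: cinner_minus_left)

lemma cinner_diff_right: "cinner x (y - z) = cinner x y - cinner x (z::'a::complex_inner)"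
  using cinner_add_right[of x y "-z"] by (simp add: cinner_minus_right)

lemma cinner_zero_left: "cinner 0 (x::'a::complex_inner) = 0"
  using cinner_diff_left[of 0 0 x] by simp

lemma cinner_zero_right: "cinner (x::'a::complex_inner) 0 = 0"
  using cinner_diff_right[of x 0 0] by simp

lemma power2_norm_eq_cinner: "(norm x)\<^sup>2 = Re (cinner x (x::'a::complex_inner))"
  by (simp add: norm_eq_sqrt_cinner cinner_self_nonneg)

lemma Re_cinner_commute: "Re (cinner x y) = Re (cinner y (x::'a::complex_inner))"
  using cinner_commute[of x y] by simp

lemma cinner_scaleR_left: "cinner (r *\<^sub>R x) y = of_real r * cinner x (y::'a::complex_inner)"
  by (simp add: scaleR_scaleC cinner_scaleC_left)

lemma cinner_scaleR_right: "cinner x (r *\<^sub>R y) = of_real r * cinner x (y::'a::complex_inner)"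
  by (simp add: scaleR_scaleC cinner_scaleC_right)

lemma power2_norm_add:
  "(norm (x + y))\<^sup>2 = (norm x)\<^sup>2 + (norm y)\<^sup>2 + 2 * Re (cinner x (y::'a::complex_inner))"
  by (simp add: power2_norm_eq_cinner cinner_add_left cinner_add_right Re_cinner_commute[of y x])

lemma power2_norm_diff:
  "(norm (x - y))\<^sup>2 = (norm x)\<^sup>2 + (norm y)\<^sup>2 - 2 * Re (cinner x (y::'a::complex_inner))"
  using power2_norm_add[of x "- y"] by (simp add: cinner_minus_right)

lemma power2_norm_scaleC: "(norm (scaleC c x))\<^sup>2 = (cmod c)\<^sup>2 * (norm (x::'a::complex_inner))\<^sup>2"
proof -
  have "cinner (scaleC c x) (scaleC c x) = (cnj c * c) * cinner x x"
    by (simp add: cinner_scaleC_left cinner_scaleC_right)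
  also have "cnj c * c = of_real ((cmod c)\<^sup>2)"
    by (metis complex_norm_square mult.commute)
  finally show ?thesis by (simp add: power2_norm_eq_cinner)
qed

lemma Re_cinner_le: "Re (cinner x y) \<le> norm x * norm (y::'a::complex_inner)"
proof -
  have "(norm (x + y))\<^sup>2 \<le> (norm x + norm y)\<^sup>2"
    by (intro power_mono norm_triangle_ineq) simp
  then show ?thesis by (simp add: power2_norm_add power2_sum)
qed

lemma bounded_linear_Re_cinner: "bounded_linear (\<lambda>y. Re (cinner x (y::'a::complex_inner)))"
proof (rule bounded_linear_intro[where K = "norm x"])
  show "norm (Re (cinner x y)) \<le> norm y * norm x" for y
    using Re_cinner_le[of x y] Re_cinner_le[of x "- y"]
    by (simp add: cinner_minus_right mult.commute abs_le_iff)
qed (simp_all add: cinner_add_right cinner_scaleR_right)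

text \<open>Letting \<open>r\<close> tend to 0 makes the weight of \<open>x\<close> tend to 1.\<close>

lemma weighted_parallelogram_law:
  fixes x y :: "'a::complex_inner"
  assumes "r \<noteq> 0"
  shows "(norm (x + y))\<^sup>2 + (norm (r *\<^sub>R x - (1 / r) *\<^sub>R y))\<^sup>2
    = (1 + r\<^sup>2) * (norm x)\<^sup>2 + (1 + 1 / r\<^sup>2) * (norm y)\<^sup>2"
proof -
  have "(norm (r *\<^sub>R x - (1 / r) *\<^sub>R y))\<^sup>2
      = r\<^sup>2 * (norm x)\<^sup>2 + (1 / r\<^sup>2) * (norm y)\<^sup>2 - 2 * Re (cinner x y)"
    using assms by (simp add: power2_norm_diff cinner_scaleR_left cinner_scaleR_right
        power_mult_distrib power_divide)
  then show ?thesis by (simp add: power2_norm_add distrib_right)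
qed

section \<open>Closed subspaces and orthogonal decomposition\<close>

definition closed_csubspace :: "'a::complex_inner set \<Rightarrow> bool" where
  "closed_csubspace S \<longleftrightarrow> 0 \<in> S \<and> (\<forall>x\<in>S. \<forall>y\<in>S. x + y \<in> S) \<and> (\<forall>c. \<forall>x\<in>S. scaleC c x \<in> S) \<and> closed S"

lemma closed_csubspaceD:
  assumes "closed_csubspace S"
  shows "0 \<in> S" "x \<in> S \<Longrightarrow> y \<in> S \<Longrightarrow> x + y \<in> S" "x \<in> S \<Longrightarrow> scaleC c x \<in> S" "closed S"
    "x \<in> S \<Longrightarrow> r *\<^sub>R x \<in> S" "x \<in> S \<Longrightarrow> - x \<in> S" "x \<in> S \<Longrightarrow> y \<in> S \<Longrightarrow> x - y \<in> S"
proof -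
  show *: "0 \<in> S" "x \<in> S \<Longrightarrow> y \<in> S \<Longrightarrow> x + y \<in> S" "closed S" for x y
    using assms by (auto simp: closed_csubspace_def)
  show C: "x \<in> S \<Longrightarrow> scaleC c x \<in> S" for c x
    using assms by (auto simp: closed_csubspace_def)
  show "x \<in> S \<Longrightarrow> r *\<^sub>R x \<in> S" using C by (simp add: scaleR_scaleC)
  show m: "x \<in> S \<Longrightarrow> - x \<in> S" for x using C[of x "-1"] by (simp add: scaleC_minus1)
  show "x \<in> S \<Longrightarrow> y \<in> S \<Longrightarrow> x - y \<in> S" using *(2)[of x "- y"] m[of y] by simp
qed

lemma closed_csubspace_INT:
  assumes "\<And>i. i \<in> I \<Longrightarrow> closed_csubspace (S i)"
  shows "closed_csubspace (\<Inter>i\<in>I. S i)"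
  using assms unfolding closed_csubspace_def by (auto intro!: closed_INT)

lemma closed_csubspace_Int:
  "closed_csubspace S \<Longrightarrow> closed_csubspace S' \<Longrightarrow> closed_csubspace (S \<inter> S')"
  unfolding closed_csubspace_def by (auto intro!: closed_Int)

lemma closed_csubspace_has_sum:
  assumes "closed_csubspace S" "(f has_sum s) B" "\<And>b. b \<in> B \<Longrightarrow> f b \<in> S"
  shows "s \<in> S"
proof (rule Lim_in_closed_set[of S "sum f" "finite_subsets_at_top B"])
  have "sum f F \<in> S" if "finite F" "F \<subseteq> B" for F
    using that by induction (auto intro!: closed_csubspaceD[OF assms(1)] assms(3))
  then show "\<forall>\<^sub>F F in finite_subsets_at_top B. sum f F \<in> S"
    by (intro eventually_finite_subsets_at_top_weakI) auto
qed (use assms closed_csubspaceD(4) in \<open>auto simp: has_sum_def\<close>)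

text \<open>Since \<open>scaleC \<i> s\<close> is again in \<open>S\<close>, pairing with it turns
  the imaginary part into a real part. Orthogonality proofs can thus work with real parts
  only.\<close>

lemma cinner_eq_0_if_Re_eq_0:
  assumes "closed_csubspace S" "\<And>s. s \<in> S \<Longrightarrow> Re (cinner x s) = 0" "s \<in> S"
  shows "cinner x s = 0"
proof (rule complex_eqI)
  have "Re (cinner x (scaleC \<i> s)) = 0"
    using assms closed_csubspaceD(3) by blast
  then show "Im (cinner x s) = Im 0" by (simp add: cinner_scaleC_right)
qed (use assms in auto)

text \<open>First variation: shifting the nearest point \<open>z\<close> along \<open>s\<close>
  cannot decrease the distance, which forces the linear term to vanish.\<close>

lemma nearest_point_orthogonal:
  assumes S: "closed_csubspace S" and "z \<in> S" "s \<in> S"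
    and min: "\<And>s. s \<in> S \<Longrightarrow> norm (x - z) \<le> norm (x - s)"
  shows "cinner (x - z) s = 0"
proof -
  have "Re (cinner (x - z) s) = 0" if s: "s \<in> S" for s
  proof (cases "s = 0")
    case False
    define c where "c = Re (cinner (x - z) s)"
    \<comment> \<open>The minimiser of \<open>r\<^sup>2 * (norm s)\<^sup>2 - 2 * r * c\<close>, so
      the shift along \<open>s\<close> that exploits minimality best.\<close>
    define r where "r = c / (norm s)\<^sup>2"
    have n: "norm s > 0" using False by simp
    have "z + r *\<^sub>R s \<in> S" using s \<open>z \<in> S\<close> by (intro closed_csubspaceD[OF S])
    from min[OF this] have "norm (x - z) \<le> norm ((x - z) - r *\<^sub>R s)" by (simp add: algebra_simps)
    then have "(norm (x - z))\<^sup>2 \<le> (norm ((x - z) - r *\<^sub>R s))\<^sup>2" by (intro power_mono) auto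
    also have "\<dots> = (norm (x - z))\<^sup>2 + r\<^sup>2 * (norm s)\<^sup>2 - 2 * r * c"
      by (simp add: power2_norm_diff cinner_scaleR_right power_mult_distrib c_def)
    also have "r\<^sup>2 * (norm s)\<^sup>2 = r * c" using n by (simp add: r_def power2_eq_square)
    finally have "r * c \<le> 0" by (simp add: mult.commute)
    then have "c\<^sup>2 / (norm s)\<^sup>2 \<le> 0" by (simp add: r_def power2_eq_square)
    then have "c\<^sup>2 \<le> 0" using n by (simp add: divide_le_0_iff)
    then show ?thesis by (simp add: c_def)
  qed (simp add: cinner_zero_right)
  from cinner_eq_0_if_Re_eq_0[OF S this] \<open>s \<in> S\<close> show ?thesis by blast
qed

text \<open>A minimising sequence for the distance to \<open>S\<close> is Cauchy by the
  parallelogram law; completeness supplies its limit, and minimality makes the residual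
  orthogonal.\<close>

lemma orthogonal_decomposition:
  fixes x :: "'h::chilbert_space"
  assumes S: "closed_csubspace S"
  obtains z where "z \<in> S" "\<And>s. s \<in> S \<Longrightarrow> cinner (x - z) s = 0"
proof -
  define d where "d = (INF s\<in>S. (norm (x - s))\<^sup>2)"
  have bdd: "bdd_below ((\<lambda>s. (norm (x - s))\<^sup>2) ` S)" by (rule bdd_belowI[of _ 0]) auto
  have d_le: "d \<le> (norm (x - s))\<^sup>2" if "s \<in> S" for s
    unfolding d_def using bdd that by (rule cINF_lower)
  have "\<exists>s\<in>S. (norm (x - s))\<^sup>2 < d + 1 / Suc n" for n
    using cInf_lessD[of "(\<lambda>s. (norm (x - s))\<^sup>2) ` S" "d + 1 / Suc n"] closed_csubspaceD(1)[OF S]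
    by (auto simp: d_def)
  then obtain f where f: "\<And>n. f n \<in> S" "\<And>n. (norm (x - f n))\<^sup>2 < d + 1 / Suc n" by metis
  \<comment> \<open>The midpoint of \<open>f m\<close> and \<open>f n\<close> lies in
    \<open>S\<close>, so its squared distance from \<open>x\<close> is at least \<open>d\<close>.
    The parallelogram law turns this into a bound on \<open>f m - f n\<close>, to which each of the
    two near-minimal points contributes \<open>2 / Suc N\<close>.\<close>
  have est: "(norm (f m - f n))\<^sup>2 \<le> 4 / Suc N" if "m \<ge> N" "n \<ge> N" for m n N
  proof -
    have "(1/2) *\<^sub>R (f m + f n) \<in> S" by (intro closed_csubspaceD[OF S] f)
    then have "4 * d \<le> 4 * (norm (x - (1/2) *\<^sub>R (f m + f n)))\<^sup>2" using d_le by simp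
    also have "\<dots> = (norm (2 *\<^sub>R (x - (1/2) *\<^sub>R (f m + f n))))\<^sup>2"
      by (simp only: norm_scaleR power_mult_distrib) simp
    also have "2 *\<^sub>R (x - (1/2) *\<^sub>R (f m + f n)) = (x - f m) + (x - f n)"
      by (simp add: algebra_simps scaleR_2)
    finally have "4 * d \<le> (norm ((x - f m) + (x - f n)))\<^sup>2" .
    moreover have "(norm ((x - f m) + (x - f n)))\<^sup>2 + (norm (f m - f n))\<^sup>2
        = 2 * (norm (x - f m))\<^sup>2 + 2 * (norm (x - f n))\<^sup>2"
      using weighted_parallelogram_law[of 1 "x - f m" "x - f n"] by (simp add: norm_minus_commute)
    moreover have "1 / real (Suc m) \<le> 1 / Suc N" "1 / real (Suc n) \<le> 1 / Suc N"
      using that by (auto intro!: divide_left_mono)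
    ultimately show ?thesis using f(2)[of m] f(2)[of n] by linarith
  qed
  have "Cauchy f"
  proof (rule metric_CauchyI)
    fix e :: real assume "e > 0"
    then obtain N where N: "4 / e\<^sup>2 < real (Suc N)" using reals_Archimedean2[of "4 / e\<^sup>2"]
      by (metis less_trans lessI of_nat_less_iff)
    have "norm (f m - f n) < e" if "m \<ge> N" "n \<ge> N" for m n
    proof -
      have "4 / real (Suc N) < e\<^sup>2" using N \<open>e > 0\<close> by (simp add: field_simps)
      then have "(norm (f m - f n))\<^sup>2 < e\<^sup>2" using est[OF that] by linarith
      then show ?thesis using \<open>e > 0\<close> by (simp add: power_less_imp_less_base)
    qed
    then show "\<exists>M. \<forall>m\<ge>M. \<forall>n\<ge>M. dist (f m) (f n) < e" by (auto simp: dist_norm)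
  qed
  then obtain z where z: "f \<longlonglongrightarrow> z" using Cauchy_convergent convergentD by blast
  have zS: "z \<in> S" using closed_sequentially[OF closed_csubspaceD(4)[OF S]] f(1) z by blast
  have "(\<lambda>n. (norm (x - f n))\<^sup>2) \<longlonglongrightarrow> (norm (x - z))\<^sup>2" by (intro tendsto_intros z)
  moreover have "(\<lambda>n. d + 1 / Suc n) \<longlonglongrightarrow> d + 0"
    by (intro tendsto_intros LIMSEQ_Suc[OF lim_1_over_n])
  ultimately have "(norm (x - z))\<^sup>2 \<le> d"
    using f(2) by (intro LIMSEQ_le[of "\<lambda>n. (norm (x - f n))\<^sup>2" _ "\<lambda>n. d + 1 / Suc n"]) (auto intro: less_imp_le)
  then have "norm (x - z) \<le> norm (x - s)" if "s \<in> S" for s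
    using order_trans[OF _ d_le[OF that]] by (meson norm_ge_zero power2_le_imp_le)
  from nearest_point_orthogonal[OF S zS _ this] that[OF zS] show ?thesis by blast
qed

text \<open>The difference of two candidates lies in \<open>S\<close> and is orthogonal to
  \<open>S\<close>, hence to itself.\<close>

lemma orthogonal_decomposition_unique:
  assumes S: "closed_csubspace S"
    and "z \<in> S" "\<And>s. s \<in> S \<Longrightarrow> cinner (x - z) s = 0"
    and "z' \<in> S" "\<And>s. s \<in> S \<Longrightarrow> cinner (x - z') s = 0"
  shows "z = z'"
proof -
  have "z' - z \<in> S" by (intro closed_csubspaceD[OF S] assms)
  moreover have "cinner (z' - z) s = cinner (x - z) s - cinner (x - z') s" for s
    by (simp add: cinner_diff_left)
  ultimately have "cinner (z' - z) (z' - z) = 0" using assms by simp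
  then show ?thesis by (simp add: cinner_self_eq_zero)
qed

section \<open>Projections and their ranges\<close>

lemma is_projD:
  assumes "is_proj P"
  shows "bounded_linear P" "P (scaleC c x) = scaleC c (P x)"
    "cinner (P x) y = cinner x (P y)" "P (P x) = P x"
    "P (x + y) = P x + P y" "P (x - y) = P x - P y" "P (r *\<^sub>R x) = r *\<^sub>R P x" "P 0 = 0"
  using assms linear_0[of P] linear_add[of P] linear_diff[of P] linear_scale[of P]
  by (auto simp: is_proj_def bounded_linear.linear)

lemma is_proj_power2_norm: "is_proj P \<Longrightarrow> (norm (P x))\<^sup>2 = Re (cinner x (P x))"
  by (metis is_projD(3,4) power2_norm_eq_cinner)

lemma is_proj_orthogonal: "is_proj P \<Longrightarrow> cinner (x - P x) (P y) = 0"
  by (simp add: cinner_diff_left is_projD)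

lemma range_is_proj: "is_proj P \<Longrightarrow> range P = {x. P x = x}"
  by (auto simp: is_projD(4)) (metis rangeI)

lemma closed_csubspace_range_is_proj:
  assumes P: "is_proj P"
  shows "closed_csubspace (range P)"
proof -
  have "closed {x. P x = x}"
    by (intro closed_Collect_eq linear_continuous_on is_projD(1)[OF P] continuous_on_id)
  then show ?thesis
    unfolding closed_csubspace_def range_is_proj[OF P] by (simp add: is_projD[OF P])
qed

text \<open>\<open>P x\<close> and \<open>Q x\<close> both solve the orthogonal decomposition of
  \<open>x\<close> with respect to the common range.\<close>

lemma is_proj_unique:
  assumes P: "is_proj P" and Q: "is_proj Q" and "range P = range Q"
  shows "P = Q"
proof
  fix x
  have "cinner (x - P x) s = 0" "cinner (x - Q x) s = 0" if "s \<in> range P" for s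
    using that is_proj_orthogonal[OF P] is_proj_orthogonal[OF Q] assms(3) by (metis rangeE)+
  with assms show "P x = Q x"
    by (intro orthogonal_decomposition_unique[OF closed_csubspace_range_is_proj[OF P], where x = x]) auto
qed

text \<open>Send each \<open>x\<close> to its component in \<open>S\<close>. Linearity follows from
  uniqueness: it suffices that the candidate value lies in \<open>S\<close> and leaves an orthogonal
  residual.\<close>

lemma ex_is_proj:
  fixes S :: "'h::chilbert_space set"
  assumes S: "closed_csubspace S"
  shows "\<exists>P. is_proj P \<and> range P = S"
proof -
  have "\<exists>z. z \<in> S \<and> (\<forall>s\<in>S. cinner (x - z) s = 0)" for x
    using orthogonal_decomposition[OF S, of x] by metis
  then obtain P where PS: "\<And>x. P x \<in> S" and orth: "\<And>x s. s \<in> S \<Longrightarrow> cinner (x - P x) s = 0"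
    by metis
  have eq: "P x = z" if "z \<in> S" "\<And>s. s \<in> S \<Longrightarrow> cinner (x - z) s = 0" for x z
    using orthogonal_decomposition_unique[OF S PS orth that] by blast
  have id_on: "P x = x" if "x \<in> S" for x using that by (intro eq) (auto simp: cinner_zero_left)
  have add: "P (x + y) = P x + P y" for x y
    by (rule eq) (use orth PS closed_csubspaceD[OF S] in
        \<open>auto simp: add_diff_add cinner_add_left\<close>)
  have scale: "P (scaleC c x) = scaleC c (P x)" for c x
  proof (rule eq)
    fix s assume s: "s \<in> S"
    have "cinner (scaleC c x - scaleC c (P x)) s = cnj c * cinner (x - P x) s"
      by (simp add: cinner_diff_left cinner_scaleC_left algebra_simps)
    then show "cinner (scaleC c x - scaleC c (P x)) s = 0" using orth[OF s] by simp
  qed (intro closed_csubspaceD[OF S] PS)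
  have self: "cinner (P x) y = cinner x (P y)" for x y
  proof -
    have "cinner (P x) (y - P y) = 0" "cinner (x - P x) (P y) = 0"
      using orth PS cinner_commute[of "P x" "y - P y"] by auto
    then show ?thesis by (simp add: cinner_diff_left cinner_diff_right)
  qed
  have "norm (P x) \<le> norm x * 1" for x
  proof -
    have "(norm (P x))\<^sup>2 = Re (cinner x (P x))"
      using self[of x "P x"] id_on[OF PS, of x] by (simp add: power2_norm_eq_cinner)
    also have "\<dots> \<le> norm x * norm (P x)" by (rule Re_cinner_le)
    finally show ?thesis by (cases "norm (P x) = 0") (auto simp: power2_eq_square)
  qed
  then have "bounded_linear P"
    by (intro bounded_linear_intro[where K = 1]) (auto simp: add scaleR_scaleC scale)
  then have "is_proj P" unfolding is_proj_def by (auto simp: scale self id_on PS)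
  moreover have "range P = S" using id_on PS by (metis image_subset_iff rangeI subsetI subset_antisym)
  ultimately show ?thesis by blast
qed

text \<open>Existence and uniqueness make the definite description in \<open>proj_onto\<close>
  meaningful.\<close>

lemma
  fixes S :: "'h::chilbert_space set"
  assumes "closed_csubspace S"
  shows is_proj_proj_onto: "is_proj (proj_onto S)"
    and range_proj_onto: "range (proj_onto S) = S"
proof -
  have "\<exists>!P. is_proj P \<and> range P = S" using ex_is_proj[OF assms] is_proj_unique by blast
  from theI'[OF this] show "is_proj (proj_onto S)" "range (proj_onto S) = S"
    unfolding proj_onto_def by auto
qed

lemma proj_onto_in: "closed_csubspace S \<Longrightarrow> proj_onto S (x::'h::chilbert_space) \<in> S"
  using range_proj_onto by blast

lemma proj_onto_orthogonal:
  "closed_csubspace S \<Longrightarrow> s \<in> S \<Longrightarrow> cinner (x - proj_onto S (x::'h::chilbert_space)) s = 0"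
  by (metis is_proj_orthogonal is_proj_proj_onto range_proj_onto rangeE)

lemma proj_onto_id: "closed_csubspace S \<Longrightarrow> x \<in> S \<Longrightarrow> proj_onto S x = (x::'h::chilbert_space)"
  using range_is_proj[OF is_proj_proj_onto[of S]] range_proj_onto[of S] by auto

lemma proj_onto_eqI:
  fixes x :: "'h::chilbert_space"
  assumes "closed_csubspace S" "z \<in> S" "\<And>s. s \<in> S \<Longrightarrow> cinner (x - z) s = 0"
  shows "proj_onto S x = z"
  using orthogonal_decomposition_unique[OF assms(1) proj_onto_in proj_onto_orthogonal] assms by blast

section \<open>The subspace on which a family commutes\<close>

lemma oprod_simps [simp]: "oprod [] = id" "oprod (w # ws) = w \<circ> oprod ws"
  by (simp_all add: oprod_def)

lemma oprod_append: "oprod (ws @ vs) = oprod ws \<circ> oprod vs"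
  by (induction ws) (auto simp: fun_eq_iff)

lemma Hrho_cong_factors:
  assumes "\<phi> \<in> Hrho T \<Delta> p" "set ws \<subseteq> fam_ops T \<Delta> p" "mset ws = mset vs"
  shows "oprod ws \<phi> = oprod vs \<phi>"
  using assms mset_eq_setD[OF assms(3)] unfolding Hrho_def by blast

text \<open>\<open>oprod\<close> applies its last factor first, so appending \<open>w\<close> to
  both words tests them on \<open>w \<phi>\<close>.\<close>

lemma Hrho_invariant:
  assumes "\<phi> \<in> Hrho T \<Delta> p" "w \<in> fam_ops T \<Delta> p"
  shows "w \<phi> \<in> Hrho T \<Delta> p"
proof -
  have "oprod ws (w \<phi>) = oprod vs (w \<phi>)"
    if "set ws \<subseteq> fam_ops T \<Delta> p" "mset ws = mset vs" for ws vs
    using Hrho_cong_factors[OF assms(1), of "ws @ [w]" "vs @ [w]"] that assms(2)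
    by (simp add: oprod_append)
  then show ?thesis unfolding Hrho_def by blast
qed

lemma Hrho_commute:
  assumes "\<phi> \<in> Hrho T \<Delta> p" "v \<in> fam_ops T \<Delta> p" "w \<in> fam_ops T \<Delta> p"
  shows "v (w \<phi>) = w (v \<phi>)"
  using Hrho_cong_factors[OF assms(1), of "[v, w]" "[w, v]"] assms(2,3) by simp

text \<open>On an invariant set, commutation of pairs suffices: a permutation of a word can be built
  by moving one factor at a time to the front.\<close>

lemma subset_HrhoI:
  assumes inv: "\<And>w \<phi>. w \<in> fam_ops T \<Delta> p \<Longrightarrow> \<phi> \<in> K \<Longrightarrow> w \<phi> \<in> K"
    and comm: "\<And>v w \<phi>. v \<in> fam_ops T \<Delta> p \<Longrightarrow> w \<in> fam_ops T \<Delta> p \<Longrightarrow> \<phi> \<in> K \<Longrightarrow> v (w \<phi>) = w (v \<phi>)"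
  shows "K \<subseteq> Hrho T \<Delta> p"
proof
  fix \<phi> assume \<phi>: "\<phi> \<in> K"
  have oprod_K: "oprod ws \<phi> \<in> K" if "set ws \<subseteq> fam_ops T \<Delta> p" for ws
    using that by (induction ws) (auto simp: \<phi> inv)
  \<comment> \<open>At each swap of neighbours the vector they act on still lies in
    \<open>K\<close>, by \<open>oprod_K\<close>, so the pairwise hypothesis applies.\<close>
  have move: "oprod (as @ w # bs) \<phi> = w (oprod (as @ bs) \<phi>)"
    if "set (as @ w # bs) \<subseteq> fam_ops T \<Delta> p" for as w bs
    using that by (induction as) (use oprod_K comm in auto)
  have "oprod ws \<phi> = oprod vs \<phi>" if "set ws \<subseteq> fam_ops T \<Delta> p" "mset ws = mset vs" for ws vs
    using that
  proof (induction ws arbitrary: vs)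
    case (Cons w ws)
    then have "w \<in> set vs" by (metis list.set_intros(1) mset_eq_setD)
    then obtain as bs where vs: "vs = as @ w # bs" by (meson split_list)
    have "set (as @ w # bs) \<subseteq> fam_ops T \<Delta> p"
      using Cons.prems mset_eq_setD[OF Cons.prems(2)] vs by auto
    then show ?case using Cons.IH[of "as @ bs"] Cons.prems move[of as w bs] by (simp add: vs)
  qed simp
  then show "\<phi> \<in> Hrho T \<Delta> p" unfolding Hrho_def by blast
qed

text \<open>The set is an intersection of equalisers of bounded, complex-linear products.\<close>

lemma closed_csubspace_Hrho:
  assumes "\<And>w. w \<in> fam_ops T \<Delta> p \<Longrightarrow> is_proj w"
  shows "closed_csubspace (Hrho T \<Delta> p)"
proof -
  define I where "I = {(ws, vs). set ws \<subseteq> fam_ops T \<Delta> p \<and> set vs \<subseteq> fam_ops T \<Delta> p \<and> mset ws = mset vs}"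
  have op: "bounded_linear (oprod ws) \<and> (\<forall>c \<phi>. oprod ws (scaleC c \<phi>) = scaleC c (oprod ws \<phi>))"
    if "set ws \<subseteq> fam_ops T \<Delta> p" for ws
    using that
  proof (induction ws)
    case (Cons w ws)
    then have "is_proj w" using assms by auto
    from bounded_linear_compose[OF is_projD(1)[OF this], of "oprod ws"] is_projD(2)[OF this]
    show ?case using Cons by (simp add: comp_def)
  qed (simp add: id_def bounded_linear_ident)
  have "closed_csubspace {\<phi>. oprod ws \<phi> = oprod vs \<phi>}" if "(ws, vs) \<in> I" for ws vs
  proof -
    have 1: "bounded_linear (oprod ws)" "bounded_linear (oprod vs)"
      using op that by (auto simp: I_def)
    then have "closed {\<phi>. oprod ws \<phi> = oprod vs \<phi>}"
      by (intro closed_Collect_eq linear_continuous_on)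
    then show ?thesis
      using op[of ws] op[of vs] that 1[THEN bounded_linear.linear]
      by (auto simp: closed_csubspace_def I_def linear_0 linear_add)
  qed
  then have "closed_csubspace (\<Inter>i\<in>I. {\<phi>. oprod (fst i) \<phi> = oprod (snd i) \<phi>})"
    by (intro closed_csubspace_INT) auto
  also have "(\<Inter>i\<in>I. {\<phi>. oprod (fst i) \<phi> = oprod (snd i) \<phi>}) = Hrho T \<Delta> p"
    unfolding Hrho_def I_def set_eq_iff by (simp add: split_paired_all) blast
  finally show ?thesis .
qed

section \<open>One family of projections and its finite meets\<close>

locale projection_family =
  fixes T :: "'t set" and \<Delta> :: "'t \<Rightarrow> 'c set" and p :: "'t \<Rightarrow> 'c \<Rightarrow> 'h::chilbert_space \<Rightarrow> 'h"
  assumes family: "proj_family T \<Delta> p"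
begin

abbreviation "H \<equiv> Hrho T \<Delta> p"
abbreviation "\<Omega> \<equiv> Omega_rho T \<Delta>"
abbreviation "\<S> \<equiv> Sigma_rho T \<Delta>"

text \<open>The operator written p with upper indices t_i and lower indices a_i. Indexing by the set
  of pairs (t_i, a_i) makes order and repetition disappear.\<close>

definition meet :: "('t \<times> 'c) set \<Rightarrow> 'h \<Rightarrow> 'h" where
  "meet F = pmeet ((\<lambda>(t, a). p t a) ` F)"

lemma
  assumes "t \<in> T"
  shows countable_index: "countable (\<Delta> t)"
    and is_proj_p: "a \<in> \<Delta> t \<Longrightarrow> is_proj (p t a)"
    and has_sum_p: "((\<lambda>a. p t a \<phi>) has_sum \<phi>) (\<Delta> t)"
  using family assms unfolding proj_family_def by blast+

lemma p_fam_ops: "t \<in> T \<Longrightarrow> a \<in> \<Delta> t \<Longrightarrow> p t a \<in> fam_ops T \<Delta> p"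
  by (auto simp: fam_ops_def)

lemma is_proj_fam_ops: "w \<in> fam_ops T \<Delta> p \<Longrightarrow> is_proj w"
  by (auto simp: fam_ops_def is_proj_p)

lemma closed_csubspace_H: "closed_csubspace H"
  by (rule closed_csubspace_Hrho) (rule is_proj_fam_ops)

lemmas H_simps = closed_csubspaceD[OF closed_csubspace_H]

lemma p_in_H: "\<phi> \<in> H \<Longrightarrow> t \<in> T \<Longrightarrow> a \<in> \<Delta> t \<Longrightarrow> p t a \<phi> \<in> H"
  using Hrho_invariant[OF _ p_fam_ops] .

lemma p_commute:
  "\<phi> \<in> H \<Longrightarrow> t \<in> T \<Longrightarrow> a \<in> \<Delta> t \<Longrightarrow> s \<in> T \<Longrightarrow> b \<in> \<Delta> s \<Longrightarrow> p t a (p s b \<phi>) = p s b (p t a \<phi>)"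
  using Hrho_commute[OF _ p_fam_ops p_fam_ops] .

text \<open>Pair the resolution of the identity with \<open>\<phi>\<close>; for a projection, the
  real part of this pairing is the squared norm of the image.\<close>

lemma has_sum_power2_norm_p:
  assumes "t \<in> T"
  shows "((\<lambda>a. (norm (p t a \<phi>))\<^sup>2) has_sum (norm \<phi>)\<^sup>2) (\<Delta> t)"
proof -
  have "((\<lambda>a. Re (cinner \<phi> (p t a \<phi>))) has_sum Re (cinner \<phi> \<phi>)) (\<Delta> t)"
    by (rule has_sum_bounded_linear[OF bounded_linear_Re_cinner has_sum_p[OF assms]])
  then show ?thesis
    unfolding power2_norm_eq_cinner[of \<phi>]
    by (subst has_sum_cong[where g = "\<lambda>a. Re (cinner \<phi> (p t a \<phi>))"])
      (simp_all add: is_proj_power2_norm is_proj_p assms)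
qed

text \<open>Apply the norm identity to \<open>p t b \<phi>\<close>: the term at \<open>b\<close>
  already exhausts the total, so nothing remains for \<open>a\<close>.\<close>

lemma p_orthogonal:
  assumes t: "t \<in> T" and ab: "a \<in> \<Delta> t" "b \<in> \<Delta> t" "a \<noteq> b"
  shows "p t a (p t b \<phi>) = 0"
proof -
  have "(\<Sum>c\<in>{a, b}. (norm (p t c (p t b \<phi>)))\<^sup>2) \<le> (norm (p t b \<phi>))\<^sup>2"
    by (rule finite_sum_le_has_sum[OF has_sum_power2_norm_p[OF t]]) (use ab in auto)
  then have "(norm (p t a (p t b \<phi>)))\<^sup>2 \<le> 0"
    using ab is_projD(4)[OF is_proj_p[OF t ab(2)]] by simp
  then show ?thesis by simp
qed

lemma closed_csubspace_ranges:
  "F \<subseteq> Sigma T \<Delta> \<Longrightarrow> closed_csubspace (\<Inter>P\<in>(\<lambda>(t, a). p t a) ` F. range P)"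
  by (intro closed_csubspace_INT) (auto intro!: closed_csubspace_range_is_proj is_proj_p)

lemma is_proj_meet: "F \<subseteq> Sigma T \<Delta> \<Longrightarrow> is_proj (meet F)"
  unfolding meet_def pmeet_def by (intro is_proj_proj_onto closed_csubspace_ranges)

lemma meet_fixed:
  assumes "F \<subseteq> Sigma T \<Delta>" "(t, a) \<in> F"
  shows "p t a (meet F \<phi>) = meet F \<phi>"
proof -
  have "meet F \<phi> \<in> range (p t a)"
    using proj_onto_in[OF closed_csubspace_ranges[OF assms(1)], of \<phi>] assms(2)
    by (auto simp: meet_def pmeet_def)
  then show ?thesis using range_is_proj[OF is_proj_p] assms by fast
qed

lemma meet_id:
  assumes "F \<subseteq> Sigma T \<Delta>" "\<And>t a. (t, a) \<in> F \<Longrightarrow> p t a \<phi> = \<phi>"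
  shows "meet F \<phi> = \<phi>"
proof -
  have "\<phi> \<in> range (p t a)" if "(t, a) \<in> F" for t a using assms(2)[OF that] by (metis rangeI)
  then show ?thesis
    unfolding meet_def pmeet_def by (intro proj_onto_id[OF closed_csubspace_ranges[OF assms(1)]]) auto
qed

lemma meet_empty [simp]: "meet {} \<phi> = \<phi>"
  by (rule meet_id) auto

lemma meet_inconsistent:
  assumes "F \<subseteq> Sigma T \<Delta>" "(t, a) \<in> F" "(t, b) \<in> F" "a \<noteq> b"
  shows "meet F \<phi> = 0"
proof -
  have "meet F \<phi> = p t a (p t b (meet F \<phi>))" using meet_fixed assms by simp
  also have "\<dots> = 0" using assms by (intro p_orthogonal) auto
  finally show ?thesis .
qed

text \<open>On commuting vectors the meet acts as a product. The hypothesis concerns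
  \<open>meet F \<phi>\<close>, so that the induction for \<open>meet_in_H\<close> can use this
  lemma.\<close>

lemma meet_insert_aux:
  assumes F: "F \<subseteq> Sigma T \<Delta>" and t: "t \<in> T" "a \<in> \<Delta> t" and mF: "meet F \<phi> \<in> H"
  shows "meet (insert (t, a) F) \<phi> = p t a (meet F \<phi>)"
proof -
  have F': "insert (t, a) F \<subseteq> Sigma T \<Delta>" using F t by auto
  show ?thesis
    unfolding meet_def[of "insert _ _"] pmeet_def
  proof (rule proj_onto_eqI[OF closed_csubspace_ranges[OF F']])
    have "p t a (meet F \<phi>) \<in> range (p s b)" if "(s, b) \<in> F" for s b
    proof -
      have sb: "s \<in> T" "b \<in> \<Delta> s" using F that by auto
      have "p s b (p t a (meet F \<phi>)) = p t a (meet F \<phi>)"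
        using p_commute[OF mF sb t] meet_fixed[OF F that] by simp
      then show ?thesis by (metis rangeI)
    qed
    then show "p t a (meet F \<phi>) \<in> (\<Inter>P\<in>(\<lambda>(t, a). p t a) ` insert (t, a) F. range P)" by auto
  next
    fix s assume s: "s \<in> (\<Inter>P\<in>(\<lambda>(t, a). p t a) ` insert (t, a) F. range P)"
    have fix_s: "p u b s = s" if "(u, b) \<in> insert (t, a) F" for u b
    proof -
      have "s \<in> range (p u b)" using s that by force
      then show ?thesis using range_is_proj[OF is_proj_p] that F' by fast
    qed
    then have "meet F s = s" by (intro meet_id[OF F]) auto
    \<comment> \<open>Self-adjointness moves both operators onto \<open>s\<close>, which each of
      them fixes.\<close>
    then show "cinner (\<phi> - p t a (meet F \<phi>)) s = 0"
      using fix_s[of t a] is_projD(3)[OF is_proj_p[OF t]] is_projD(3)[OF is_proj_meet[OF F]]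
      by (simp add: cinner_diff_left)
  qed
qed

lemma meet_in_H:
  assumes "finite F" "F \<subseteq> Sigma T \<Delta>" "\<phi> \<in> H"
  shows "meet F \<phi> \<in> H"
  using assms
proof (induction F)
  case (insert x F)
  obtain s b where x: "x = (s, b)" by (cases x)
  from insert.prems x have sb: "s \<in> T" "b \<in> \<Delta> s" and F: "F \<subseteq> Sigma T \<Delta>" by auto
  have "meet F \<phi> \<in> H" using insert.IH F insert.prems by blast
  then show ?case using meet_insert_aux[OF F sb] p_in_H sb x by simp
qed simp

lemma meet_insert:
  "finite F \<Longrightarrow> F \<subseteq> Sigma T \<Delta> \<Longrightarrow> \<phi> \<in> H \<Longrightarrow> t \<in> T \<Longrightarrow> a \<in> \<Delta> t
    \<Longrightarrow> meet (insert (t, a) F) \<phi> = p t a (meet F \<phi>)"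
  by (simp add: meet_insert_aux meet_in_H)

end

section \<open>Extension of consistent weights to a measure\<close>

lemma nn_integral_count_space_has_sum:
  fixes f :: "'a \<Rightarrow> real"
  assumes "(f has_sum s) A" "\<And>x. x \<in> A \<Longrightarrow> f x \<ge> 0"
  shows "(\<integral>\<^sup>+x. ennreal (f x) \<partial>count_space A) = ennreal s"
proof -
  have "(\<lambda>x. norm (f x)) summable_on A"
    using assms has_sum_imp_summable by (subst summable_on_cong[of A _ f]) auto
  from abs_summable_equivalent[THEN iffD1, OF this] show ?thesis
    using assms by (simp add: nn_integral_conv_infsetsum infsetsum_infsum infsumI)
qed

lemma emeasure_point_measure_eq:
  assumes "X \<subseteq> A"
  shows "emeasure (point_measure A f) X = (\<integral>\<^sup>+x. f x \<partial>count_space X)"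
proof -
  have "emeasure (point_measure A f) X = (\<integral>\<^sup>+x. f x * indicator X x \<partial>count_space A)"
    unfolding point_measure_def using assms by (subst emeasure_density) auto
  also have "\<dots> = (\<integral>\<^sup>+x. f x * indicator X x \<partial>count_space X)"
    by (rule nn_integral_count_space_eq) (use assms in auto)
  also have "\<dots> = (\<integral>\<^sup>+x. f x \<partial>count_space X)"
    by (rule nn_integral_cong) auto
  finally show ?thesis .
qed

section \<open>Path space and its measurable events\<close>

lemma Sigma_rho_eq_sets:
  "Sigma_rho T \<Delta> = sets (sigma (Omega_rho T \<Delta>) {{\<omega> \<in> Omega_rho T \<Delta>. \<omega> t = a} | t a. t \<in> T \<and> a \<in> \<Delta> t})"
  unfolding Sigma_rho_def by (subst sets_measure_of) auto

lemma sigma_algebra_Sigma_rho: "sigma_algebra (Omega_rho T \<Delta>) (Sigma_rho T \<Delta>)"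
  unfolding Sigma_rho_def by (rule sigma_algebra_sigma_sets) auto

lemma coordinate_in_Sigma_rho:
  "t \<in> T \<Longrightarrow> a \<in> \<Delta> t \<Longrightarrow> {\<omega> \<in> Omega_rho T \<Delta>. \<omega> t = a} \<in> Sigma_rho T \<Delta>"
  unfolding Sigma_rho_def by (rule sigma_sets.Basic) auto

lemma cyl_in_Sigma_rho:
  assumes "finite F" "F \<subseteq> Sigma T \<Delta>"
  shows "cyl T \<Delta> F \<in> Sigma_rho T \<Delta>"
proof -
  interpret sigma_algebra "Omega_rho T \<Delta>" "Sigma_rho T \<Delta>" by (rule sigma_algebra_Sigma_rho)
  have "{\<omega> \<in> Omega_rho T \<Delta>. \<forall>f\<in>F. \<omega> (fst f) = snd f} \<in> Sigma_rho T \<Delta>"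
    using assms by (intro sets_Collect_finite_All coordinate_in_Sigma_rho) auto
  then show ?thesis by (simp add: cyl_def case_prod_beta)
qed

text \<open>The countable index sets are encoded as sets of natural numbers inside the reals, so that
  Kolmogorov's extension theorem for Polish state spaces applies.\<close>

locale consistent_weights =
  fixes T :: "'t set" and \<Delta> :: "'t \<Rightarrow> 'c set" and w :: "('t \<times> 'c) set \<Rightarrow> real"
  assumes countable_states: "t \<in> T \<Longrightarrow> countable (\<Delta> t)"
    and states_nonempty: "t \<in> T \<Longrightarrow> \<Delta> t \<noteq> {}"
    and weight_nonneg: "w F \<ge> 0"
    and weight_empty: "w {} = 1"
    and weight_inconsistent:
      "F \<subseteq> Sigma T \<Delta> \<Longrightarrow> (t, a) \<in> F \<Longrightarrow> (t, b) \<in> F \<Longrightarrow> a \<noteq> b \<Longrightarrow> w F = 0"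
    and weight_marginal:
      "finite F \<Longrightarrow> F \<subseteq> Sigma T \<Delta> \<Longrightarrow> t \<in> T \<Longrightarrow> ((\<lambda>a. w (insert (t, a) F)) has_sum w F) (\<Delta> t)"
begin

section \<open>Finite-dimensional distributions and their consistency\<close>

definition graph_on :: "'t set \<Rightarrow> ('t \<Rightarrow> 'c) \<Rightarrow> ('t \<times> 'c) set" where
  "graph_on J \<omega> = (\<lambda>t. (t, \<omega> t)) ` J"

text \<open>The joint law of the coordinates in \<open>J\<close>: a discrete measure giving each
  point the weight of its graph.\<close>

definition marg :: "'t set \<Rightarrow> ('t \<Rightarrow> 'c) measure" where
  "marg J = point_measure (Pi\<^sub>E J \<Delta>) (\<lambda>\<omega>. ennreal (w (graph_on J \<omega>)))"

lemma space_marg [simp]: "space (marg J) = Pi\<^sub>E J \<Delta>"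
  by (simp add: marg_def space_point_measure)

lemma sets_marg [simp]: "sets (marg J) = Pow (Pi\<^sub>E J \<Delta>)"
  by (simp add: marg_def sets_point_measure)

lemma measurable_marg [simp]: "measurable (marg J) N = Pi\<^sub>E J \<Delta> \<rightarrow> space N"
  by (auto simp: measurable_def)

lemma emeasure_marg_singleton: "\<omega> \<in> Pi\<^sub>E J \<Delta> \<Longrightarrow> emeasure (marg J) {\<omega>} = ennreal (w (graph_on J \<omega>))"
  unfolding marg_def by (subst emeasure_point_measure_finite2) auto

text \<open>Both measures live on a countable space, so it suffices to compare singletons; summing
  the weights over the fibre of a point is exactly \<open>weight_marginal\<close>.\<close>

lemma marg_insert:
  assumes J: "finite J" "J \<subseteq> T" and t: "t \<in> T" "t \<notin> J"
  shows "marg J = distr (marg (insert t J)) (marg J) (\<lambda>\<omega>. restrict \<omega> J)"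
proof (rule measure_eqI_countable[where A = "Pi\<^sub>E J \<Delta>"])
  show "countable (Pi\<^sub>E J \<Delta>)" using J countable_states by (intro countable_PiE) auto
next
  fix \<omega> assume \<omega>: "\<omega> \<in> Pi\<^sub>E J \<Delta>"
  \<comment> \<open>The fibre of the restriction map over \<open>\<omega>\<close>.\<close>
  let ?X = "(\<lambda>c. fun_upd \<omega> t c) ` \<Delta> t"
  have X: "?X \<subseteq> Pi\<^sub>E (insert t J) \<Delta>" using \<omega> by (auto simp: PiE_iff extensional_def split: if_splits)
  have eq: "(\<lambda>\<omega>. restrict \<omega> J) -` {\<omega>} \<inter> space (marg (insert t J)) = ?X"
  proof (intro equalityI subsetI)
    fix \<eta> assume "\<eta> \<in> (\<lambda>\<omega>. restrict \<omega> J) -` {\<omega>} \<inter> space (marg (insert t J))"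
    then have \<eta>: "\<eta> \<in> Pi\<^sub>E (insert t J) \<Delta>" "\<omega> = restrict \<eta> J" by auto
    then have "\<eta> = fun_upd \<omega> t (\<eta> t)" by (auto simp: fun_eq_iff PiE_iff extensional_def)
    then show "\<eta> \<in> ?X" using \<eta>(1) by (auto simp: PiE_iff)
  next
    fix \<eta> assume "\<eta> \<in> ?X"
    then show "\<eta> \<in> (\<lambda>\<omega>. restrict \<omega> J) -` {\<omega>} \<inter> space (marg (insert t J))"
      using X \<omega> t by (auto simp: fun_eq_iff PiE_iff extensional_def)
  qed
  have graph: "graph_on (insert t J) (fun_upd \<omega> t c) = insert (t, c) (graph_on J \<omega>)" for c
    using t by (auto simp: graph_on_def)
  have "bij_betw (\<lambda>c. fun_upd \<omega> t c) (\<Delta> t) ?X"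
    by (auto simp: bij_betw_def inj_on_def fun_upd_eqD)
  from nn_integral_bij_count_space[OF this, of "\<lambda>\<eta>. ennreal (w (graph_on (insert t J) \<eta>))"]
  have "emeasure (marg (insert t J)) ?X = (\<integral>\<^sup>+c. ennreal (w (insert (t, c) (graph_on J \<omega>))) \<partial>count_space (\<Delta> t))"
    unfolding marg_def by (simp add: emeasure_point_measure_eq[OF X] graph)
  also have "\<dots> = ennreal (w (graph_on J \<omega>))"
    using J t \<omega> by (intro nn_integral_count_space_has_sum weight_marginal weight_nonneg)
      (auto simp: graph_on_def PiE_iff)
  finally show "emeasure (marg J) {\<omega>} = emeasure (distr (marg (insert t J)) (marg J) (\<lambda>\<omega>. restrict \<omega> J)) {\<omega>}"
    using \<omega> by (subst emeasure_distr) (auto simp: eq[unfolded space_marg] emeasure_marg_singleton)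
qed simp_all

text \<open>The extra coordinates are removed one at a time, and restrictions compose.\<close>

lemma marg_restrict:
  assumes J: "finite J" "J \<subseteq> T" and I: "finite I" "I \<subseteq> T" "I \<inter> J = {}"
  shows "marg J = distr (marg (I \<union> J)) (marg J) (\<lambda>\<omega>. restrict \<omega> J)"
  using I
proof (induction I)
  case empty
  have "distr (marg J) (marg J) (\<lambda>\<omega>. restrict \<omega> J) = distr (marg J) (marg J) (\<lambda>\<omega>. \<omega>)"
    by (rule distr_cong) auto
  then show ?case by (simp add: distr_id2 del: restrict_apply)
next
  case (insert t I)
  then have I: "marg J = distr (marg (I \<union> J)) (marg J) (\<lambda>\<omega>. restrict \<omega> J)"
    using insert.IH insert.prems by blast
  note I
  also have "distr (marg (I \<union> J)) (marg J) (\<lambda>\<omega>. restrict \<omega> J)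
      = distr (distr (marg (insert t (I \<union> J))) (marg (I \<union> J)) (\<lambda>\<omega>. restrict \<omega> (I \<union> J)))
      (marg J) (\<lambda>\<omega>. restrict \<omega> J)"
    by (rule arg_cong[where f = "\<lambda>M. distr M (marg J) (\<lambda>\<omega>. restrict \<omega> J)"], rule marg_insert)
      (use J insert in auto)
  also have "\<dots> = distr (marg (insert t (I \<union> J))) (marg J) ((\<lambda>\<omega>. restrict \<omega> J) \<circ> (\<lambda>\<omega>. restrict \<omega> (I \<union> J)))"
    by (rule distr_distr) (auto split: if_splits)
  also have "(\<lambda>\<omega>. restrict \<omega> J) \<circ> (\<lambda>\<omega>. restrict \<omega> (I \<union> J)) = (\<lambda>\<omega>::'t \<Rightarrow> 'c. restrict \<omega> J)"
    by (auto simp: fun_eq_iff)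
  finally show ?case by simp
qed

lemma prob_space_marg:
  assumes "finite J" "J \<subseteq> T"
  shows "prob_space (marg J)"
proof (rule prob_space_distrD)
  show "(\<lambda>\<omega>. restrict \<omega> {}) \<in> measurable (marg J) (marg {})" by auto
  \<comment> \<open>Total mass is read off after projecting to no coordinates:
    \<open>\<lambda>_. undefined\<close> is the only point there, and it carries the weight of the
    empty set.\<close>
  have "emeasure (marg {}) {\<lambda>_. undefined} = 1"
    by (simp add: emeasure_marg_singleton graph_on_def weight_empty)
  then have "prob_space (marg {})" by (intro prob_spaceI) simp
  then show "prob_space (distr (marg J) (marg {}) (\<lambda>\<omega>. restrict \<omega> {}))"
    using marg_restrict[of "{}" J] assms by simp
qed

section \<open>Encoding into the reals and the Kolmogorov limit\<close>

definition enc :: "'t set \<Rightarrow> ('t \<Rightarrow> 'c) \<Rightarrow> 't \<Rightarrow> real" where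
  "enc J \<omega> = (\<lambda>t\<in>J. real (to_nat_on (\<Delta> t) (\<omega> t)))"

text \<open>Every real decodes to a state, also a negative or fractional one (see
  \<open>dec_in\<close>). Hence every decoded path lies in \<open>Omega_rho T \<Delta>\<close>, and
  no exceptional null set has to be removed.\<close>

definition dec :: "'t \<Rightarrow> real \<Rightarrow> 'c" where
  "dec t x = from_nat_into (\<Delta> t) (nat \<lfloor>x\<rfloor>)"

lemma dec_enc: "t \<in> J \<Longrightarrow> t \<in> T \<Longrightarrow> \<omega> t \<in> \<Delta> t \<Longrightarrow> dec t (enc J \<omega> t) = \<omega> t"
  by (simp add: dec_def enc_def countable_states)

lemma dec_in: "t \<in> T \<Longrightarrow> dec t x \<in> \<Delta> t"
  by (simp add: dec_def from_nat_into states_nonempty)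

lemma measurable_dec: "dec t \<in> measurable borel (count_space UNIV)"
  unfolding dec_def by measurable

abbreviation emarg :: "'t set \<Rightarrow> ('t \<Rightarrow> real) measure" where
  "emarg J \<equiv> distr (marg J) (PiM J (\<lambda>_. borel)) (enc J)"

lemma measurable_enc: "enc J \<in> measurable (marg J) (PiM J (\<lambda>_. borel))"
  by (auto simp: enc_def space_PiM)

text \<open>Encoding acts coordinatewise and so commutes with restriction; this carries the
  consistency of \<open>marg\<close> over to the encoded laws.\<close>

sublocale polish_projective T emarg
proof (rule polish_projective.intro[OF projective_family.intro])
  fix J H :: "'t set" assume JH: "J \<subseteq> H" "finite H" "H \<subseteq> T"
  then have J: "finite J" "J \<subseteq> T" using finite_subset by auto
  have "marg J = distr (marg H) (marg J) (\<lambda>\<omega>. restrict \<omega> J)"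
    using marg_restrict[OF J, of "H - J"] JH by (simp add: Un_absorb2) blast
  then have "emarg J = distr (distr (marg H) (marg J) (\<lambda>\<omega>. restrict \<omega> J)) (PiM J (\<lambda>_. borel)) (enc J)"
    by simp
  also have "\<dots> = distr (marg H) (PiM J (\<lambda>_. borel)) (enc J \<circ> (\<lambda>\<omega>. restrict \<omega> J))"
    using JH by (intro distr_distr measurable_enc) auto
  also have "enc J \<circ> (\<lambda>\<omega>. restrict \<omega> J) = (\<lambda>f. restrict f J) \<circ> enc H"
    using JH by (auto simp: enc_def fun_eq_iff)
  also have "distr (marg H) (PiM J (\<lambda>_. borel)) ((\<lambda>f. restrict f J) \<circ> enc H)
      = distr (emarg H) (PiM J (\<lambda>_. borel)) (\<lambda>f. restrict f J)"
    using JH by (intro distr_distr[symmetric] measurable_enc measurable_restrict_subset)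
  finally show "emarg J = distr (emarg H) (PiM J (\<lambda>_. borel)) (\<lambda>f. restrict f J)" .
next
  fix J assume "finite J" "J \<subseteq> T"
  then show "prob_space (emarg J)"
    using prob_space.prob_space_distr[OF prob_space_marg measurable_enc] by blast
qed

definition limit_measure :: "('t \<Rightarrow> 'c) measure" where
  "limit_measure = distr lim
    (sigma (Omega_rho T \<Delta>) {{\<omega> \<in> Omega_rho T \<Delta>. \<omega> t = a} | t a. t \<in> T \<and> a \<in> \<Delta> t})
    (\<lambda>x. \<lambda>t\<in>T. dec t (x t))"

lemma space_limit_measure: "space limit_measure = Omega_rho T \<Delta>"
  unfolding limit_measure_def by (simp add: space_measure_of_conv)

lemma sets_limit_measure: "sets limit_measure = Sigma_rho T \<Delta>"
  unfolding limit_measure_def Sigma_rho_eq_sets by simp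

lemma sets_dec_vimage:
  assumes "t \<in> I"
  shows "{x \<in> space (PiM I (\<lambda>_. borel)). dec t (x t) = a} \<in> sets (PiM I (\<lambda>_. borel))"
proof -
  have "(\<lambda>x. dec t (x t)) \<in> measurable (PiM I (\<lambda>_. borel)) (count_space UNIV)"
    using assms by (intro measurable_compose[OF _ measurable_dec] measurable_component_singleton)
  from measurable_sets[OF this, of "{a}"] show ?thesis
    by (simp add: vimage_def Int_def conj_commute)
qed

lemma measurable_decode:
  "(\<lambda>x. \<lambda>t\<in>T. dec t (x t)) \<in> measurable lim
    (sigma (Omega_rho T \<Delta>) {{\<omega> \<in> Omega_rho T \<Delta>. \<omega> t = a} | t a. t \<in> T \<and> a \<in> \<Delta> t})"
proof (rule measurable_measure_of)
  show dec_space: "(\<lambda>x. \<lambda>t\<in>T. dec t (x t)) \<in> space lim \<rightarrow> Omega_rho T \<Delta>"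
    by (auto simp: Omega_rho_def dec_in)
  fix Y assume "Y \<in> {{\<omega> \<in> Omega_rho T \<Delta>. \<omega> t = a} | t a. t \<in> T \<and> a \<in> \<Delta> t}"
  then obtain t a where Y: "Y = {\<omega> \<in> Omega_rho T \<Delta>. \<omega> t = a}" "t \<in> T" by auto
  then have "(\<lambda>x. \<lambda>t\<in>T. dec t (x t)) -` Y \<inter> space lim
      = {x \<in> space (PiM T (\<lambda>_. borel)). dec t (x t) = a}"
    using dec_space by auto
  then show "(\<lambda>x. \<lambda>t\<in>T. dec t (x t)) -` Y \<inter> space lim \<in> sets lim"
    using sets_dec_vimage[OF Y(2)] by simp
qed auto

lemma prob_space_limit_measure: "prob_space limit_measure"
  unfolding limit_measure_def using measurable_decode by (rule P.prob_space_distr)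

text \<open>If \<open>F\<close> prescribes two values at one index, the cylinder is empty and the
  weight vanishes; otherwise \<open>F\<close> is the graph of a single point.\<close>

lemma measure_marg_cylinder:
  assumes F: "finite F" "F \<subseteq> Sigma T \<Delta>"
  shows "measure (marg (fst ` F)) {\<omega> \<in> Pi\<^sub>E (fst ` F) \<Delta>. \<forall>(t, a)\<in>F. \<omega> t = a} = w F"
proof (cases "\<exists>t a b. (t, a) \<in> F \<and> (t, b) \<in> F \<and> a \<noteq> b")
  case True
  then have "w F = 0" using weight_inconsistent F by blast
  moreover have "{\<omega> \<in> Pi\<^sub>E (fst ` F) \<Delta>. \<forall>(t, a)\<in>F. \<omega> t = a} = {}"
    using True by (auto simp: split_beta) (metis fst_conv snd_conv)
  ultimately show ?thesis by (simp only: measure_empty)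
next
  case False
  define \<omega> where "\<omega> = (\<lambda>t\<in>fst ` F. SOME a. (t, a) \<in> F)"
  have \<omega>: "\<omega> t = a" if "(t, a) \<in> F" for t a
  proof -
    have "(t, SOME a. (t, a) \<in> F) \<in> F" using that by (rule someI)
    then have "(SOME a. (t, a) \<in> F) = a" using False that by blast
    then show ?thesis using that by (force simp: \<omega>_def)
  qed
  have graph: "graph_on (fst ` F) \<omega> = F" using \<omega> by (force simp: graph_on_def image_iff)
  have mem: "\<omega> \<in> Pi\<^sub>E (fst ` F) \<Delta>"
  proof (rule PiE_I)
    show "\<omega> t \<in> \<Delta> t" if "t \<in> fst ` F" for t using that \<omega> F(2) by auto
  qed (simp add: \<omega>_def)
  moreover have "\<eta> = \<omega>" if "\<eta> \<in> Pi\<^sub>E (fst ` F) \<Delta>" "\<forall>(t, a)\<in>F. \<eta> t = a" for \<eta>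
    using that(1) mem
  proof (rule PiE_ext)
    fix t assume "t \<in> fst ` F"
    then show "\<eta> t = \<omega> t" using that(2) \<omega> by auto
  qed
  ultimately have "{\<omega> \<in> Pi\<^sub>E (fst ` F) \<Delta>. \<forall>(t, a)\<in>F. \<omega> t = a} = {\<omega>}" using \<omega> by auto
  then show ?thesis
    using emeasure_marg_singleton[OF mem] by (simp add: graph measure_def weight_nonneg)
qed

lemma measure_limit_measure_cyl:
  assumes F: "finite F" "F \<subseteq> Sigma T \<Delta>"
  shows "measure limit_measure (cyl T \<Delta> F) = w F"
proof -
  define J where "J = fst ` F"
  have J: "finite J" "J \<subseteq> T" using F by (auto simp: J_def)
  \<comment> \<open>The cylinder seen on encoded paths over \<open>J\<close>.\<close>
  define X where "X = {x \<in> space (PiM J (\<lambda>_. borel)). \<forall>(t, a)\<in>F. dec t (x t) = a}"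
  have X: "X \<in> sets (PiM J (\<lambda>_. borel))"
  proof -
    have "{x \<in> space (PiM J (\<lambda>_. borel)). \<forall>f\<in>F. dec (fst f) (x (fst f)) = snd f} \<in> sets (PiM J (\<lambda>_. borel))"
      using F(1) by (intro sets.sets_Collect_finite_All sets_dec_vimage) (auto simp: J_def)
    then show ?thesis by (simp add: X_def case_prod_beta)
  qed
  have cyl_sets: "cyl T \<Delta> F \<in> Sigma_rho T \<Delta>" using F by (rule cyl_in_Sigma_rho)
  have "measure limit_measure (cyl T \<Delta> F) = measure lim ((\<lambda>x. \<lambda>t\<in>T. dec t (x t)) -` cyl T \<Delta> F \<inter> space lim)"
    unfolding limit_measure_def using cyl_sets
    by (intro measure_distr measurable_decode) (simp add: Sigma_rho_eq_sets)
  also have "(\<lambda>x. \<lambda>t\<in>T. dec t (x t)) -` cyl T \<Delta> F \<inter> space lim = emb T J X"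
    using F(2) J(2) by (force simp: cyl_def prod_emb_def X_def space_PiM Omega_rho_def dec_in J_def)
  also have "measure lim (emb T J X) = measure (emarg J) X"
    using J X by (intro measure_lim_emb)
  also have "\<dots> = measure (marg J) (enc J -` X \<inter> space (marg J))"
    using X by (intro measure_distr measurable_enc)
  also have "enc J -` X \<inter> space (marg J) = {\<omega> \<in> Pi\<^sub>E J \<Delta>. \<forall>(t, a)\<in>F. \<omega> t = a}"
  proof -
    have "dec t (enc J \<omega> t) = \<omega> t" if "(t, a) \<in> F" "\<omega> \<in> Pi\<^sub>E J \<Delta>" for t a \<omega>
      using that F(2) by (intro dec_enc) (force simp: J_def PiE_iff)+
    moreover have "enc J \<omega> \<in> space (PiM J (\<lambda>_. borel))" for \<omega> by (auto simp: enc_def space_PiM)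
    ultimately show ?thesis by (auto simp: X_def)
  qed
  finally show ?thesis using measure_marg_cylinder[OF F] by (simp add: J_def)
qed

end

section \<open>Spectral measures and the subspaces of events\<close>

text \<open>Unlike the coordinate events, the cylinders are stable under intersection, as Dynkin's
  argument requires of a generator.\<close>

lemma sigma_sets_cyl:
  "Sigma_rho T \<Delta> = sigma_sets (Omega_rho T \<Delta>) {cyl T \<Delta> F | F. finite F \<and> F \<subseteq> Sigma T \<Delta>}"
  unfolding Sigma_rho_def
proof (rule sigma_sets_eqI)
  fix X assume "X \<in> {{\<omega> \<in> Omega_rho T \<Delta>. \<omega> t = a} | t a. t \<in> T \<and> a \<in> \<Delta> t}"
  then obtain t a where "X = cyl T \<Delta> {(t, a)}" "t \<in> T" "a \<in> \<Delta> t" by (auto simp: cyl_def)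
  then show "X \<in> sigma_sets (Omega_rho T \<Delta>) {cyl T \<Delta> F | F. finite F \<and> F \<subseteq> Sigma T \<Delta>}"
    by (intro sigma_sets.Basic CollectI exI[of _ "{(t, a)}"]) auto
next
  fix X assume "X \<in> {cyl T \<Delta> F | F. finite F \<and> F \<subseteq> Sigma T \<Delta>}"
  then show "X \<in> sigma_sets (Omega_rho T \<Delta>) {{\<omega> \<in> Omega_rho T \<Delta>. \<omega> t = a} | t a. t \<in> T \<and> a \<in> \<Delta> t}"
    using cyl_in_Sigma_rho unfolding Sigma_rho_def by blast
qed

text \<open>These two properties are what a Dynkin induction consumes, and they pass to linear
  combinations; an identity between measures becomes the vanishing of one such function.\<close>

definition signed_measure_on :: "'a set \<Rightarrow> 'a set set \<Rightarrow> ('a set \<Rightarrow> real) \<Rightarrow> bool" where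
  "signed_measure_on \<Omega> \<S> f \<longleftrightarrow> (\<forall>A\<in>\<S>. f (\<Omega> - A) = f \<Omega> - f A) \<and>
    (\<forall>A::nat \<Rightarrow> 'a set. range A \<subseteq> \<S> \<longrightarrow> disjoint_family A \<longrightarrow> (\<lambda>i. f (A i)) sums f (\<Union>i. A i))"

lemma signed_measure_on_measure:
  assumes "finite_measure M" "space M = \<Omega>" "sets M = \<S>"
  shows "signed_measure_on \<Omega> \<S> (measure M)"
proof -
  interpret finite_measure M by fact
  show ?thesis
    using assms(2,3) finite_measure_compl finite_measure_UNION by (auto simp: signed_measure_on_def)
qed

lemma signed_measure_on_add:
  "signed_measure_on \<Omega> \<S> f \<Longrightarrow> signed_measure_on \<Omega> \<S> g \<Longrightarrow> signed_measure_on \<Omega> \<S> (\<lambda>A. f A + g A)"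
  unfolding signed_measure_on_def by (simp add: sums_add)

lemma signed_measure_on_diff:
  "signed_measure_on \<Omega> \<S> f \<Longrightarrow> signed_measure_on \<Omega> \<S> g \<Longrightarrow> signed_measure_on \<Omega> \<S> (\<lambda>A. f A - g A)"
  unfolding signed_measure_on_def by (simp add: sums_diff)

lemma signed_measure_on_cmult:
  "signed_measure_on \<Omega> \<S> f \<Longrightarrow> signed_measure_on \<Omega> \<S> (\<lambda>A. c * f A)"
  unfolding signed_measure_on_def by (simp add: sums_mult right_diff_distrib)

text \<open>Dynkin's argument: the events on which \<open>f\<close> vanishes contain the cylinders
  and are closed under complements and countable disjoint unions.\<close>

lemma signed_measure_eq_0_if_cyl:
  assumes f: "signed_measure_on (Omega_rho T \<Delta>) (Sigma_rho T \<Delta>) f"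
    and cyl: "\<And>F. finite F \<Longrightarrow> F \<subseteq> Sigma T \<Delta> \<Longrightarrow> f (cyl T \<Delta> F) = 0"
    and "A \<in> Sigma_rho T \<Delta>"
  shows "f A = 0"
proof -
  let ?G = "{cyl T \<Delta> F | F. finite F \<and> F \<subseteq> Sigma T \<Delta>}"
  have Omega: "f (Omega_rho T \<Delta>) = 0" using cyl[of "{}"] by (simp add: cyl_def)
  have "Int_stable ?G"
  proof (rule Int_stableI)
    fix X Y assume "X \<in> ?G" "Y \<in> ?G"
    then obtain F F' where F: "X = cyl T \<Delta> F" "finite F" "F \<subseteq> Sigma T \<Delta>"
      and F': "Y = cyl T \<Delta> F'" "finite F'" "F' \<subseteq> Sigma T \<Delta>" by blast
    have "X \<inter> Y = cyl T \<Delta> (F \<union> F')" using F(1) F'(1) by (auto simp: cyl_def ball_Un)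
    then show "X \<inter> Y \<in> ?G" using F F' by (intro CollectI exI[of _ "F \<union> F'"]) auto
  qed
  moreover have "?G \<subseteq> Pow (Omega_rho T \<Delta>)" by (auto simp: cyl_def)
  moreover have "A \<in> sigma_sets (Omega_rho T \<Delta>) ?G" using assms(3) by (simp add: sigma_sets_cyl)
  ultimately show ?thesis
  proof (induction rule: sigma_sets_induct_disjoint)
    case (basic A)
    then show ?case using cyl by blast
  next
    case empty
    \<comment> \<open>The complement rule for the whole space gives \<open>f {} = 0\<close>.\<close>
    have "Omega_rho T \<Delta> \<in> Sigma_rho T \<Delta>"
      unfolding Sigma_rho_def by (rule sigma_sets_top)
    then show ?case using f Omega unfolding signed_measure_on_def by fastforce
  next
    case (compl A)
    then have "A \<in> Sigma_rho T \<Delta>" by (simp add: sigma_sets_cyl)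
    with compl.IH show ?case using f Omega by (simp add: signed_measure_on_def)
  next
    case (union A)
    then have "(\<lambda>i. f (A i)) sums f (\<Union>i. A i)"
      using f unfolding signed_measure_on_def sigma_sets_cyl by blast
    moreover have "(\<lambda>i. f (A i)) sums 0" using union.IH by simp
    ultimately show ?case by (rule sums_unique2)
  qed
qed

section \<open>Spectral measures as quadratic forms\<close>

context projection_family
begin

lemma measure_eqI_cyl:
  assumes "prob_space M" "space M = \<Omega>" "sets M = \<S>" "prob_space N" "space N = \<Omega>" "sets N = \<S>"
    and "\<And>F. finite F \<Longrightarrow> F \<subseteq> Sigma T \<Delta> \<Longrightarrow> measure M (cyl T \<Delta> F) = measure N (cyl T \<Delta> F)"
  shows "M = N"
proof (rule measure_eqI)
  interpret M: prob_space M by fact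
  interpret N: prob_space N by fact
  fix A assume A: "A \<in> sets M"
  have "measure M A - measure N A = 0"
  proof (rule signed_measure_eq_0_if_cyl[where f = "\<lambda>A. measure M A - measure N A"])
    show "signed_measure_on \<Omega> \<S> (\<lambda>A. measure M A - measure N A)"
      by (intro signed_measure_on_diff signed_measure_on_measure assms
          M.finite_measure_axioms N.finite_measure_axioms)
    show "A \<in> \<S>" using A assms(3) by simp
  qed (simp add: assms(7))
  then show "emeasure M A = emeasure N A"
    by (simp add: M.emeasure_eq_measure N.emeasure_eq_measure)
qed (use assms in simp)

lemma index_nonempty:
  assumes "(\<phi>::'h) \<noteq> 0" "t \<in> T"
  shows "\<Delta> t \<noteq> {}"
proof
  assume "\<Delta> t = {}"
  then have "((\<lambda>a. p t a \<phi>) has_sum \<phi>) {}" using has_sum_p[OF assms(2)] by metis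
  then show False using assms(1) has_sum_unique[OF _ has_sum_empty] by blast
qed

text \<open>The marginal condition is the norm identity \<open>has_sum_power2_norm_p\<close> for the
  vector \<open>meet F \<phi>\<close>; membership in \<open>H\<close> lets
  \<open>meet_insert\<close> identify the summands.\<close>

lemma consistent_weights_meet:
  assumes \<phi>: "\<phi> \<in> H" "norm \<phi> = 1"
  shows "consistent_weights T \<Delta> (\<lambda>F. (norm (meet F \<phi>))\<^sup>2)"
proof
  have "\<phi> \<noteq> 0" using \<phi> by auto
  then show "\<Delta> t \<noteq> {}" if "t \<in> T" for t using index_nonempty that by blast
  show "((\<lambda>a. (norm (meet (insert (t, a) F) \<phi>))\<^sup>2) has_sum (norm (meet F \<phi>))\<^sup>2) (\<Delta> t)"
    if "finite F" "F \<subseteq> Sigma T \<Delta>" "t \<in> T" for F t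
    using has_sum_power2_norm_p[OF that(3), of "meet F \<phi>"]
    by (subst has_sum_cong[where g = "\<lambda>a. (norm (p t a (meet F \<phi>)))\<^sup>2"])
      (auto simp: meet_insert that \<phi>)
qed (use \<phi> in \<open>auto simp: countable_index meet_inconsistent\<close>)

text \<open>The definite description in \<open>Pphi\<close> is justified: the Kolmogorov limit gives
  existence, agreement on cylinders gives uniqueness.\<close>

lemma Pphi_spec:
  assumes \<phi>: "\<phi> \<in> H" "\<phi> \<noteq> 0"
  shows "prob_space (Pphi T \<Delta> p \<phi>)" "space (Pphi T \<Delta> p \<phi>) = \<Omega>" "sets (Pphi T \<Delta> p \<phi>) = \<S>"
    "\<And>F. finite F \<Longrightarrow> F \<subseteq> Sigma T \<Delta> \<Longrightarrow>
      measure (Pphi T \<Delta> p \<phi>) (cyl T \<Delta> F) = (norm (meet F (inverse (norm \<phi>) *\<^sub>R \<phi>)))\<^sup>2"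
proof -
  let ?\<psi> = "inverse (norm \<phi>) *\<^sub>R \<phi>"
  have "?\<psi> \<in> H" "norm ?\<psi> = 1" using \<phi> by (auto intro: H_simps)
  then interpret consistent_weights T \<Delta> "\<lambda>F. (norm (meet F ?\<psi>))\<^sup>2" by (rule consistent_weights_meet)
  define Q where "Q M \<longleftrightarrow> prob_space M \<and> space M = \<Omega> \<and> sets M = \<S>
      \<and> (\<forall>F. finite F \<and> F \<subseteq> Sigma T \<Delta> \<longrightarrow> measure M (cyl T \<Delta> F) = (norm (meet F ?\<psi>))\<^sup>2)" for M
  have "Q limit_measure"
    unfolding Q_def using prob_space_limit_measure space_limit_measure sets_limit_measure
      measure_limit_measure_cyl by blast
  moreover have "M = limit_measure" if "Q M" for M
    using that \<open>Q limit_measure\<close> unfolding Q_def by (intro measure_eqI_cyl) auto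
  ultimately have "\<exists>!M. Q M" by blast
  then have "Q (THE M. Q M)" by (rule theI')
  then have "Q (Pphi T \<Delta> p \<phi>)" unfolding Q_def Pphi_def meet_def .
  then show "prob_space (Pphi T \<Delta> p \<phi>)" "space (Pphi T \<Delta> p \<phi>) = \<Omega>" "sets (Pphi T \<Delta> p \<phi>) = \<S>"
    "\<And>F. finite F \<Longrightarrow> F \<subseteq> Sigma T \<Delta> \<Longrightarrow>
      measure (Pphi T \<Delta> p \<phi>) (cyl T \<Delta> F) = (norm (meet F ?\<psi>))\<^sup>2"
    unfolding Q_def by auto
qed

text \<open>The unnormalised spectral measure is a quadratic form in \<open>\<phi>\<close>, and it makes sense for \<open>\<phi> = 0\<close>.\<close>

definition \<mu> :: "'h \<Rightarrow> ('t \<Rightarrow> 'c) set \<Rightarrow> real" where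
  "\<mu> \<phi> A = (norm \<phi>)\<^sup>2 * measure (Pphi T \<Delta> p \<phi>) A"

lemma \<mu>_nonneg: "\<mu> \<phi> A \<ge> 0"
  by (simp add: \<mu>_def)

lemma signed_measure_on_\<mu>:
  assumes "\<phi> \<in> H"
  shows "signed_measure_on \<Omega> \<S> (\<mu> \<phi>)"
proof (cases "\<phi> = 0")
  case True
  then show ?thesis by (simp add: \<mu>_def signed_measure_on_def)
next
  case False
  interpret prob_space "Pphi T \<Delta> p \<phi>" using Pphi_spec(1)[OF assms False] .
  have "\<mu> \<phi> = (\<lambda>A. (norm \<phi>)\<^sup>2 * measure (Pphi T \<Delta> p \<phi>) A)" by (auto simp: \<mu>_def)
  moreover have "signed_measure_on \<Omega> \<S> (measure (Pphi T \<Delta> p \<phi>))"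
    using finite_measure_axioms Pphi_spec[OF assms False] by (intro signed_measure_on_measure) auto
  ultimately show ?thesis by (simp add: signed_measure_on_cmult)
qed

lemma \<mu>_cyl:
  assumes "\<phi> \<in> H" "finite F" "F \<subseteq> Sigma T \<Delta>"
  shows "\<mu> \<phi> (cyl T \<Delta> F) = (norm (meet F \<phi>))\<^sup>2"
proof (cases "\<phi> = 0")
  case True
  then show ?thesis using is_projD(8)[OF is_proj_meet[OF assms(3)]] by (simp add: \<mu>_def)
next
  case False
  then show ?thesis
    using Pphi_spec(4)[OF assms(1) False assms(2,3)] is_projD(7)[OF is_proj_meet[OF assms(3)]]
    by (simp add: \<mu>_def power_mult_distrib divide_simps mult.commute)
qed

lemma \<mu>_Omega: "\<phi> \<in> H \<Longrightarrow> \<mu> \<phi> \<Omega> = (norm \<phi>)\<^sup>2"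
  using \<mu>_cyl[of \<phi> "{}"] by (simp add: cyl_def)

lemma \<mu>_compl: "\<phi> \<in> H \<Longrightarrow> A \<in> \<S> \<Longrightarrow> \<mu> \<phi> (\<Omega> - A) = (norm \<phi>)\<^sup>2 - \<mu> \<phi> A"
  using signed_measure_on_\<mu> \<mu>_Omega by (simp add: signed_measure_on_def)

lemma \<mu>_mono:
  assumes "\<phi> \<in> H" "B \<in> \<S>" "A \<subseteq> B"
  shows "\<mu> \<phi> A \<le> \<mu> \<phi> B"
proof (cases "\<phi> = 0")
  case False
  interpret prob_space "Pphi T \<Delta> p \<phi>" using Pphi_spec(1)[OF assms(1) False] .
  show ?thesis using assms Pphi_spec(3)[OF assms(1) False]
    by (auto simp: \<mu>_def intro!: mult_left_mono finite_measure_mono)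
qed (simp add: \<mu>_def)

lemma \<mu>_le: "\<phi> \<in> H \<Longrightarrow> A \<in> \<S> \<Longrightarrow> \<mu> \<phi> A \<le> (norm \<phi>)\<^sup>2"
  using \<mu>_compl[of \<phi> A] \<mu>_nonneg[of \<phi> "\<Omega> - A"] by simp

lemma \<mu>_UN_null:
  assumes "\<phi> \<in> H" "\<And>i::nat. A i \<in> \<S>" "\<And>i. \<mu> \<phi> (A i) = 0"
  shows "\<mu> \<phi> (\<Union>i. A i) = 0"
proof (cases "\<phi> = 0")
  case False
  interpret prob_space "Pphi T \<Delta> p \<phi>" using Pphi_spec(1)[OF assms(1) False] .
  have "A i \<in> null_sets (Pphi T \<Delta> p \<phi>)" for i
    using assms(2,3)[of i] False Pphi_spec(3)[OF assms(1) False]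
    by (auto simp: \<mu>_def emeasure_eq_measure)
  then have "(\<Union>i. A i) \<in> null_sets (Pphi T \<Delta> p \<phi>)" by auto
  then show ?thesis by (simp add: \<mu>_def measure_def null_setsD1)
qed (simp add: \<mu>_def)

text \<open>On a cylinder this is the norm identity for the linear images
  \<open>meet F \<phi>\<close> and \<open>meet F \<psi>\<close>; Dynkin's argument extends it to all
  events.\<close>

lemma \<mu>_weighted_parallelogram:
  assumes \<phi>: "\<phi> \<in> H" and \<psi>: "\<psi> \<in> H" and A: "A \<in> \<S>" and r: "r \<noteq> 0"
  shows "\<mu> (\<phi> + \<psi>) A + \<mu> (r *\<^sub>R \<phi> - (1 / r) *\<^sub>R \<psi>) A = (1 + r\<^sup>2) * \<mu> \<phi> A + (1 + 1 / r\<^sup>2) * \<mu> \<psi> A"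
proof -
  define f where "f = (\<lambda>A. (\<mu> (\<phi> + \<psi>) A + \<mu> (r *\<^sub>R \<phi> - (1 / r) *\<^sub>R \<psi>) A)
      - ((1 + r\<^sup>2) * \<mu> \<phi> A + (1 + 1 / r\<^sup>2) * \<mu> \<psi> A))"
  have H: "\<phi> + \<psi> \<in> H" "r *\<^sub>R \<phi> - (1 / r) *\<^sub>R \<psi> \<in> H" using \<phi> \<psi> by (auto intro!: H_simps)
  have "f A = 0"
  proof (rule signed_measure_eq_0_if_cyl[OF _ _ A])
    show "signed_measure_on \<Omega> \<S> f"
      unfolding f_def
      by (intro signed_measure_on_diff signed_measure_on_add signed_measure_on_cmult
          signed_measure_on_\<mu> \<phi> \<psi> H)
    show "f (cyl T \<Delta> F) = 0" if F: "finite F" "F \<subseteq> Sigma T \<Delta>" for F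
      using weighted_parallelogram_law[OF r, of "meet F \<phi>" "meet F \<psi>"] is_projD[OF is_proj_meet[OF F(2)]]
      by (simp add: f_def \<mu>_cyl \<phi> \<psi> H F)
  qed
  then show ?thesis by (simp add: f_def)
qed

lemma \<mu>_add_le:
  assumes "\<phi> \<in> H" "\<psi> \<in> H" "A \<in> \<S>" "r \<noteq> 0"
  shows "\<mu> (\<phi> + \<psi>) A \<le> (1 + r\<^sup>2) * \<mu> \<phi> A + (1 + 1 / r\<^sup>2) * \<mu> \<psi> A"
  using \<mu>_weighted_parallelogram[OF assms] \<mu>_nonneg[of "r *\<^sub>R \<phi> - (1 / r) *\<^sub>R \<psi>" A] by linarith

text \<open>Let \<open>r\<close> tend to 0 along \<open>1 / Suc n\<close>: the coefficient of
  \<open>\<mu> \<psi> A\<close> blows up, but that term is 0. The resulting constant 1 is what the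
  orthogonality argument uses.\<close>

lemma \<mu>_add_le_if_null:
  assumes "\<phi> \<in> H" "\<psi> \<in> H" "A \<in> \<S>" "\<mu> \<psi> A = 0"
  shows "\<mu> (\<phi> + \<psi>) A \<le> \<mu> \<phi> A"
proof (rule LIMSEQ_le_const)
  have "(\<lambda>n. (1 + (1 / real (Suc n))\<^sup>2) * \<mu> \<phi> A) \<longlonglongrightarrow> (1 + 0\<^sup>2) * \<mu> \<phi> A"
    by (intro tendsto_intros LIMSEQ_Suc[OF lim_1_over_n])
  then show "(\<lambda>n. (1 + (1 / real (Suc n))\<^sup>2) * \<mu> \<phi> A) \<longlonglongrightarrow> \<mu> \<phi> A" by simp
  show "\<exists>N. \<forall>n\<ge>N. \<mu> (\<phi> + \<psi>) A \<le> (1 + (1 / real (Suc n))\<^sup>2) * \<mu> \<phi> A"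
    using \<mu>_add_le[OF assms(1-3), of "1 / real (Suc _)"] assms(4) by auto
qed

lemma \<mu>_scaleC:
  assumes "\<phi> \<in> H" "A \<in> \<S>"
  shows "\<mu> (scaleC c \<phi>) A = (cmod c)\<^sup>2 * \<mu> \<phi> A"
proof -
  define f where "f = (\<lambda>A. \<mu> (scaleC c \<phi>) A - (cmod c)\<^sup>2 * \<mu> \<phi> A)"
  have H: "scaleC c \<phi> \<in> H" using assms by (auto intro!: H_simps)
  have "f A = 0"
  proof (rule signed_measure_eq_0_if_cyl[OF _ _ assms(2)])
    show "signed_measure_on \<Omega> \<S> f"
      unfolding f_def
      by (intro signed_measure_on_diff signed_measure_on_cmult signed_measure_on_\<mu> assms H)
    show "f (cyl T \<Delta> F) = 0" if F: "finite F" "F \<subseteq> Sigma T \<Delta>" for F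
      by (simp add: f_def \<mu>_cyl assms H F is_projD(2)[OF is_proj_meet[OF F(2)]] power2_norm_scaleC)
  qed
  then show ?thesis by (simp add: f_def)
qed

section \<open>The subspaces of events\<close>

sublocale sa: sigma_algebra \<Omega> \<S>
  by (rule sigma_algebra_Sigma_rho)

text \<open>A null condition on the complement covers \<open>\<phi> = 0\<close> uniformly and is
  suited to the estimates for sums.\<close>

lemma HA_iff:
  assumes "A \<in> \<S>"
  shows "\<phi> \<in> HA T \<Delta> p A \<longleftrightarrow> \<phi> \<in> H \<and> \<mu> \<phi> (\<Omega> - A) = 0"
proof -
  have "\<phi> = 0 \<or> measure (Pphi T \<Delta> p \<phi>) A = 1 \<longleftrightarrow> \<mu> \<phi> A = (norm \<phi>)\<^sup>2" by (auto simp: \<mu>_def)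
  then show ?thesis using assms by (auto simp: HA_def \<mu>_compl)
qed

lemma HA_compl_iff: "A \<in> \<S> \<Longrightarrow> \<phi> \<in> HA T \<Delta> p (\<Omega> - A) \<longleftrightarrow> \<phi> \<in> H \<and> \<mu> \<phi> A = 0"
  using HA_iff[of "\<Omega> - A" \<phi>] sa.sets_into_space[of A] by (simp add: double_diff sa.compl_sets)

lemma HA_subset_H: "HA T \<Delta> p A \<subseteq> H"
  by (auto simp: HA_def)

lemma HA_mono:
  assumes "A \<in> \<S>" "B \<in> \<S>" "A \<subseteq> B"
  shows "HA T \<Delta> p A \<subseteq> HA T \<Delta> p B"
proof
  fix \<phi> assume "\<phi> \<in> HA T \<Delta> p A"
  then have "\<phi> \<in> H" "\<mu> \<phi> (\<Omega> - A) = 0" using assms HA_iff by auto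
  moreover then have "\<mu> \<phi> (\<Omega> - B) \<le> 0" using assms \<mu>_mono[of \<phi> "\<Omega> - A" "\<Omega> - B"] by auto
  ultimately show "\<phi> \<in> HA T \<Delta> p B" using assms \<mu>_nonneg[of \<phi> "\<Omega> - B"] by (simp add: HA_iff)
qed

lemma HA_UN_compl:
  assumes "\<And>i::nat. A i \<in> \<S>" "\<And>i. \<phi> \<in> HA T \<Delta> p (\<Omega> - A i)"
  shows "\<phi> \<in> HA T \<Delta> p (\<Omega> - (\<Union>i. A i))"
proof -
  have U: "(\<Union>i. A i) \<in> \<S>" using assms(1) by blast
  show ?thesis using assms \<mu>_UN_null[of \<phi> A] by (simp add: HA_compl_iff[OF U] HA_compl_iff)
qed

lemma HA_Omega: "HA T \<Delta> p \<Omega> = H"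
  using \<mu>_compl[OF _ sa.top] \<mu>_Omega by (auto simp: HA_iff)

text \<open>Sums are controlled by \<open>\<mu>_add_le_if_null\<close>, scalar multiples by
  homogeneity, and limits by the total mass of the error.\<close>

lemma closed_csubspace_HA:
  assumes A: "A \<in> \<S>"
  shows "closed_csubspace (HA T \<Delta> p A)"
proof -
  let ?B = "\<Omega> - A"
  have B: "?B \<in> \<S>" using A by auto
  have add: "\<mu> (\<phi> + \<psi>) ?B = 0" if "\<phi> \<in> H" "\<psi> \<in> H" "\<mu> \<phi> ?B = 0" "\<mu> \<psi> ?B = 0" for \<phi> \<psi>
    using \<mu>_add_le_if_null[OF that(1,2) B that(4)] that(3) \<mu>_nonneg[of "\<phi> + \<psi>" ?B] by simp
  have "closed (HA T \<Delta> p A)"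
    unfolding closed_sequential_limits
  proof (intro allI impI, elim conjE)
    fix f \<phi> assume f: "\<forall>n. f n \<in> HA T \<Delta> p A" and lim: "f \<longlonglongrightarrow> \<phi>"
    have fH: "f n \<in> H" "\<mu> (f n) ?B = 0" for n using f A by (auto simp: HA_iff)
    have \<phi>: "\<phi> \<in> H" using closed_sequentially[OF H_simps(4)] fH(1) lim by blast
    \<comment> \<open>As \<open>f n\<close> is null on \<open>?B\<close>, the mass of
      \<open>\<phi>\<close> there is at most that of \<open>\<phi> - f n\<close>.\<close>
    have "\<mu> \<phi> ?B \<le> (norm (\<phi> - f n))\<^sup>2" for n
    proof -
      have d: "\<phi> - f n \<in> H" using \<phi> fH by (intro H_simps)
      have "\<mu> ((\<phi> - f n) + f n) ?B \<le> \<mu> (\<phi> - f n) ?B" by (rule \<mu>_add_le_if_null[OF d fH(1) B fH(2)])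
      then show ?thesis using \<mu>_le[OF d B] by simp
    qed
    moreover have "(\<lambda>n. (norm (\<phi> - f n))\<^sup>2) \<longlonglongrightarrow> (norm (\<phi> - \<phi>))\<^sup>2" by (intro tendsto_intros lim)
    ultimately have "\<mu> \<phi> ?B \<le> (norm (\<phi> - \<phi>))\<^sup>2" by (intro LIMSEQ_le_const[where X = "\<lambda>n. (norm (\<phi> - f n))\<^sup>2"]) blast+
    then show "\<phi> \<in> HA T \<Delta> p A" using \<phi> A \<mu>_nonneg[of \<phi> ?B] by (simp add: HA_iff)
  qed
  moreover have "0 \<in> HA T \<Delta> p A" using H_simps(1) by (simp add: HA_def)
  ultimately show ?thesis
    using A B unfolding closed_csubspace_def
    by (auto simp: HA_iff add \<mu>_scaleC intro: H_simps)
qed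

text \<open>The sum \<open>\<phi> + \<psi>\<close> has mass at most
  \<open>(norm \<phi>)\<^sup>2\<close> on \<open>A\<close> and at most
  \<open>(norm \<psi>)\<^sup>2\<close> off \<open>A\<close>, so the cross term of its squared norm
  is not positive. Replacing \<open>\<psi>\<close> by \<open>- \<psi>\<close> makes the real part
  vanish.\<close>

lemma HA_orthogonal:
  assumes A: "A \<in> \<S>" and \<phi>: "\<phi> \<in> HA T \<Delta> p A" and \<psi>: "\<psi> \<in> HA T \<Delta> p (\<Omega> - A)"
  shows "cinner \<phi> \<psi> = 0"
proof -
  have B: "\<Omega> - A \<in> \<S>" using A by auto
  have le: "Re (cinner \<phi> \<psi>) \<le> 0" if "\<psi> \<in> HA T \<Delta> p (\<Omega> - A)" for \<psi>
  proof -
    have H: "\<phi> \<in> H" "\<psi> \<in> H" "\<phi> + \<psi> \<in> H"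
      using \<phi> that HA_subset_H H_simps(2) by blast+
    have "\<mu> (\<phi> + \<psi>) A \<le> \<mu> \<phi> A"
      using A that by (intro \<mu>_add_le_if_null H) (auto simp: HA_compl_iff)
    moreover have "\<mu> (\<psi> + \<phi>) (\<Omega> - A) \<le> \<mu> \<psi> (\<Omega> - A)"
      using A B \<phi> by (intro \<mu>_add_le_if_null H) (auto simp: HA_iff)
    ultimately have "(norm (\<phi> + \<psi>))\<^sup>2 \<le> (norm \<phi>)\<^sup>2 + (norm \<psi>)\<^sup>2"
      using \<mu>_compl[OF H(3) A] \<mu>_le[OF H(1) A] \<mu>_le[OF H(2) B] by (simp add: add.commute)
    then show ?thesis by (simp add: power2_norm_add)
  qed
  note sub = closed_csubspaceD[OF closed_csubspace_HA[OF B]]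
  have "Re (cinner \<phi> \<psi>) = 0" if "\<psi> \<in> HA T \<Delta> p (\<Omega> - A)" for \<psi>
    using le[OF that] le[OF sub(6)[OF that]] by (simp add: cinner_minus_right)
  from cinner_eq_0_if_Re_eq_0[OF closed_csubspace_HA[OF B] this \<psi>] show ?thesis .
qed

lemma coordinate_eq_cyl: "{\<omega> \<in> \<Omega>. \<omega> t = a} = cyl T \<Delta> {(t, a)}"
  by (auto simp: cyl_def)

lemma meet_singleton: "t \<in> T \<Longrightarrow> a \<in> \<Delta> t \<Longrightarrow> \<phi> \<in> H \<Longrightarrow> meet {(t, a)} \<phi> = p t a \<phi>"
  using meet_insert[of "{}" \<phi> t a] by simp

text \<open>The mass of \<open>\<psi>\<close> on the event is
  \<open>(norm (p t a \<psi>))\<^sup>2\<close>; for \<open>\<psi> = p t a \<phi>\<close>,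
  idempotence makes this the total mass.\<close>

lemma p_in_HA:
  assumes "\<phi> \<in> H" "t \<in> T" "a \<in> \<Delta> t"
  shows "p t a \<phi> \<in> HA T \<Delta> p {\<omega> \<in> \<Omega>. \<omega> t = a}"
proof -
  have H: "p t a \<phi> \<in> H" using assms by (rule p_in_H)
  note P = is_projD[OF is_proj_p[OF assms(2,3)]]
  have S: "{\<omega> \<in> \<Omega>. \<omega> t = a} \<in> \<S>" using coordinate_in_Sigma_rho[where \<Delta> = \<Delta>] assms by blast
  have "\<mu> \<psi> {\<omega> \<in> \<Omega>. \<omega> t = a} = (norm (p t a \<psi>))\<^sup>2" if "\<psi> \<in> H" for \<psi>
    unfolding coordinate_eq_cyl using that assms by (subst \<mu>_cyl) (auto simp: meet_singleton)
  with H show ?thesis using S by (auto simp: HA_iff \<mu>_compl P)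
qed

end

section \<open>Refinements\<close>

locale refined_family =
  coarse: projection_family S \<Gamma> p + fine: projection_family S' \<Gamma>' p'
  for S :: "'t set" and \<Gamma> :: "'t \<Rightarrow> 'c set" and p :: "'t \<Rightarrow> 'c \<Rightarrow> 'h::chilbert_space \<Rightarrow> 'h"
    and S' :: "'t set" and \<Gamma>' :: "'t \<Rightarrow> 'd set" and p' :: "'t \<Rightarrow> 'd \<Rightarrow> 'h \<Rightarrow> 'h" +
  fixes g :: "'t \<Rightarrow> 'c \<Rightarrow> 'd set"
  assumes refines: "refinement S \<Gamma> p S' \<Gamma>' p' g"
begin

section \<open>Fine paths over coarse paths\<close>

abbreviation "lift \<equiv> lift_set S S' \<Gamma>' g"

lemma S_subset: "t \<in> S \<Longrightarrow> t \<in> S'"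
  using refines unfolding refinement_def by blast

lemma
  assumes "t \<in> S"
  shows index_eq_UN: "\<Gamma>' t = (\<Union>a\<in>\<Gamma> t. g t a)"
    and g_disjoint: "a \<in> \<Gamma> t \<Longrightarrow> b \<in> \<Gamma> t \<Longrightarrow> x \<in> g t a \<Longrightarrow> x \<in> g t b \<Longrightarrow> a = b"
    and has_sum_refined: "a \<in> \<Gamma> t \<Longrightarrow> ((\<lambda>b. p' t b \<phi>) has_sum p t a \<phi>) (g t a)"
proof -
  show "\<Gamma>' t = (\<Union>a\<in>\<Gamma> t. g t a)"
    using refines assms unfolding refinement_def by blast
  have "disjoint_family_on (g t) (\<Gamma> t)" using refines assms unfolding refinement_def by blast
  then show "a \<in> \<Gamma> t \<Longrightarrow> b \<in> \<Gamma> t \<Longrightarrow> x \<in> g t a \<Longrightarrow> x \<in> g t b \<Longrightarrow> a = b"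
    unfolding disjoint_family_on_def by blast
  show "a \<in> \<Gamma> t \<Longrightarrow> ((\<lambda>b. p' t b \<phi>) has_sum p t a \<phi>) (g t a)"
    using refines assms unfolding refinement_def by blast
qed

lemma g_subset: "t \<in> S \<Longrightarrow> a \<in> \<Gamma> t \<Longrightarrow> b \<in> g t a \<Longrightarrow> b \<in> \<Gamma>' t"
  using index_eq_UN by blast

text \<open>Together with \<open>coarse_point_unique\<close> this makes \<open>lift\<close> a
  preimage under a map from fine to coarse paths, so it respects complements.\<close>

lemma coarse_point_exists:
  assumes "\<omega>' \<in> fine.\<Omega>"
  shows "\<exists>\<omega>\<in>coarse.\<Omega>. \<forall>t\<in>S. \<omega>' t \<in> g t (\<omega> t)"
proof -
  have "\<exists>a\<in>\<Gamma> t. \<omega>' t \<in> g t a" if "t \<in> S" for t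
  proof -
    have "\<omega>' t \<in> \<Gamma>' t" using assms S_subset[OF that] by (auto simp: Omega_rho_def)
    then show ?thesis using index_eq_UN[OF that] by blast
  qed
  then obtain f where f: "\<And>t. t \<in> S \<Longrightarrow> f t \<in> \<Gamma> t \<and> \<omega>' t \<in> g t (f t)" by metis
  then show ?thesis by (intro bexI[of _ "restrict f S"]) (auto simp: Omega_rho_def)
qed

lemma coarse_point_unique:
  assumes "\<omega> \<in> coarse.\<Omega>" "\<eta> \<in> coarse.\<Omega>" "\<forall>t\<in>S. \<omega>' t \<in> g t (\<omega> t)" "\<forall>t\<in>S. \<omega>' t \<in> g t (\<eta> t)"
  shows "\<omega> = \<eta>"
proof (rule PiE_ext)
  show "\<omega> \<in> Pi\<^sub>E S \<Gamma>" "\<eta> \<in> Pi\<^sub>E S \<Gamma>" using assms by (auto simp: Omega_rho_def)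
  then show "\<omega> t = \<eta> t" if "t \<in> S" for t
    using assms(3,4) that by (intro g_disjoint[of t "\<omega> t" "\<eta> t" "\<omega>' t"]) auto
qed

lemma lift_UN: "lift (\<Union>i. A i) = (\<Union>i. lift (A i))"
  by (auto simp: lift_set_def)

lemma lift_compl:
  assumes "A \<subseteq> coarse.\<Omega>"
  shows "lift (coarse.\<Omega> - A) = fine.\<Omega> - lift A"
proof (intro equalityI subsetI)
  fix \<omega>' assume "\<omega>' \<in> lift (coarse.\<Omega> - A)"
  then show "\<omega>' \<in> fine.\<Omega> - lift A"
    using coarse_point_unique[of _ _ \<omega>'] assms unfolding lift_set_def by blast
next
  fix \<omega>' assume "\<omega>' \<in> fine.\<Omega> - lift A"
  then show "\<omega>' \<in> lift (coarse.\<Omega> - A)"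
    using coarse_point_exists[of \<omega>'] unfolding lift_set_def by blast
qed

lemma lift_coordinate:
  assumes "t \<in> S" "a \<in> \<Gamma> t"
  shows "lift {\<omega> \<in> coarse.\<Omega>. \<omega> t = a} = (\<Union>b\<in>g t a. {\<omega>' \<in> fine.\<Omega>. \<omega>' t = b})"
proof (intro equalityI subsetI)
  fix \<omega>' assume "\<omega>' \<in> lift {\<omega> \<in> coarse.\<Omega>. \<omega> t = a}"
  then show "\<omega>' \<in> (\<Union>b\<in>g t a. {\<omega>' \<in> fine.\<Omega>. \<omega>' t = b})"
    using assms unfolding lift_set_def by blast
next
  fix \<omega>' assume "\<omega>' \<in> (\<Union>b\<in>g t a. {\<omega>' \<in> fine.\<Omega>. \<omega>' t = b})"
  then have \<omega>': "\<omega>' \<in> fine.\<Omega>" "\<omega>' t \<in> g t a" by auto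
  then obtain \<omega> where \<omega>: "\<omega> \<in> coarse.\<Omega>" "\<forall>t\<in>S. \<omega>' t \<in> g t (\<omega> t)"
    using coarse_point_exists by blast
  then have "\<omega> t = a"
    using assms \<omega>' by (intro g_disjoint[of t "\<omega> t" a "\<omega>' t"]) (auto simp: Omega_rho_def)
  then show "\<omega>' \<in> lift {\<omega> \<in> coarse.\<Omega>. \<omega> t = a}" using \<omega> \<omega>'(1) unfolding lift_set_def by blast
qed

text \<open>Only the generators need work: a coordinate event lifts to a union over
  \<open>g t a\<close>, which is countable as a part of \<open>\<Gamma>' t\<close>.\<close>

lemma lift_in_Sigma:
  assumes "A \<in> coarse.\<S>"
  shows "lift A \<in> fine.\<S>"
  using assms[unfolded Sigma_rho_def]
proof induction
  case (Basic A)
  then obtain t a where t: "t \<in> S" "a \<in> \<Gamma> t" and A: "A = {\<omega> \<in> coarse.\<Omega>. \<omega> t = a}" by blast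
  have "countable (g t a)"
    by (rule countable_subset[OF _ fine.countable_index[OF S_subset[OF t(1)]]]) (use g_subset[OF t] in blast)
  then have "(\<Union>b\<in>g t a. {\<omega>' \<in> fine.\<Omega>. \<omega>' t = b}) \<in> fine.\<S>"
    using t g_subset[OF t] S_subset by (intro fine.sa.countable_UN' coordinate_in_Sigma_rho image_subsetI)
  then show ?case unfolding A lift_coordinate[OF t] .
next
  case Empty
  then show ?case by (simp add: lift_set_def)
next
  case (Compl A)
  then have "A \<subseteq> coarse.\<Omega>" using coarse.sa.sets_into_space by (simp add: Sigma_rho_def)
  then show ?case using Compl.IH by (simp add: lift_compl fine.sa.compl_sets)
next
  case (Union A)
  then show ?case by (simp add: lift_UN fine.sa.countable_UN image_subset_iff)
qed

section \<open>The fine commuting subspace inside the coarse one\<close>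

lemma p_in_fine_H:
  assumes "\<phi> \<in> fine.H" "t \<in> S" "a \<in> \<Gamma> t"
  shows "p t a \<phi> \<in> fine.H"
  by (rule closed_csubspace_has_sum[OF fine.closed_csubspace_H has_sum_refined[OF assms(2,3)]])
    (use assms g_subset S_subset in \<open>auto intro: fine.p_in_H\<close>)

text \<open>Expand \<open>p t a\<close> into fine projections and pass the bounded operator
  \<open>p' s b\<close> through the sum; both sides become sums of the same terms.\<close>

lemma p_commute_fine:
  assumes \<phi>: "\<phi> \<in> fine.H" and t: "t \<in> S" "a \<in> \<Gamma> t" and s: "s \<in> S'" "b \<in> \<Gamma>' s"
  shows "p' s b (p t a \<phi>) = p t a (p' s b \<phi>)"
proof (rule has_sum_unique)
  show "((\<lambda>d. p' s b (p' t d \<phi>)) has_sum p' s b (p t a \<phi>)) (g t a)"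
    by (rule has_sum_bounded_linear[OF is_projD(1)[OF fine.is_proj_p[OF s]] has_sum_refined[OF t]])
  have "p' s b (p' t d \<phi>) = p' t d (p' s b \<phi>)" if "d \<in> g t a" for d
    using fine.p_commute[OF \<phi> s] S_subset[OF t(1)] g_subset[OF t that] by blast
  then show "((\<lambda>d. p' s b (p' t d \<phi>)) has_sum p t a (p' s b \<phi>)) (g t a)"
    by (subst has_sum_cong[of _ _ "\<lambda>d. p' t d (p' s b \<phi>)"]) (auto intro: has_sum_refined[OF t])
qed

text \<open>The same exchange once more, now expanding \<open>p s c\<close> and using that
  \<open>p t a\<close> commutes with each fine term.\<close>

lemma p_commute_on_fine_H:
  assumes \<phi>: "\<phi> \<in> fine.H" and t: "t \<in> S" "a \<in> \<Gamma> t" and s: "s \<in> S" "c \<in> \<Gamma> s"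
  shows "p s c (p t a \<phi>) = p t a (p s c \<phi>)"
proof (rule has_sum_unique)
  show "((\<lambda>b. p' s b (p t a \<phi>)) has_sum p s c (p t a \<phi>)) (g s c)" by (rule has_sum_refined[OF s])
  have "((\<lambda>b. p t a (p' s b \<phi>)) has_sum p t a (p s c \<phi>)) (g s c)"
    by (rule has_sum_bounded_linear[OF is_projD(1)[OF coarse.is_proj_p[OF t]] has_sum_refined[OF s]])
  then show "((\<lambda>b. p' s b (p t a \<phi>)) has_sum p t a (p s c \<phi>)) (g s c)"
    using p_commute_fine[OF \<phi> t S_subset[OF s(1)] g_subset[OF s]]
    by (subst has_sum_cong[of _ _ "\<lambda>b. p t a (p' s b \<phi>)"]) auto
qed

lemma fine_H_subset: "fine.H \<subseteq> coarse.H"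
proof (rule subset_HrhoI)
  fix w \<phi> assume "w \<in> fam_ops S \<Gamma> p" "\<phi> \<in> fine.H"
  then show "w \<phi> \<in> fine.H" using p_in_fine_H unfolding fam_ops_def by blast
next
  fix v w \<phi> assume "v \<in> fam_ops S \<Gamma> p" "w \<in> fam_ops S \<Gamma> p" and \<phi>: "\<phi> \<in> fine.H"
  then obtain t a s c where "v = p s c" "w = p t a" "s \<in> S" "c \<in> \<Gamma> s" "t \<in> S" "a \<in> \<Gamma> t"
    unfolding fam_ops_def by blast
  then show "v (w \<phi>) = w (v \<phi>)" using p_commute_on_fine_H[OF \<phi>] by blast
qed

text \<open>Eventually this is the common value of \<open>\<H>\<^sub>A \<inter> \<H>\<^sub>\<pi>\<^sub>'\<close> and \<open>\<H>\<^sub>A\<^sub>'\<close>.\<close>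

definition common :: "('t \<Rightarrow> 'c) set \<Rightarrow> 'h set" where
  "common A = HA S \<Gamma> p A \<inter> HA S' \<Gamma>' p' (lift A)"

lemma common_subset: "common A \<subseteq> fine.H"
  using fine.HA_subset_H by (auto simp: common_def)

lemma closed_csubspace_common: "A \<in> coarse.\<S> \<Longrightarrow> closed_csubspace (common A)"
  unfolding common_def
  by (intro closed_csubspace_Int coarse.closed_csubspace_HA fine.closed_csubspace_HA lift_in_Sigma)

lemma common_Omega: "common coarse.\<Omega> = fine.H"
proof -
  have "lift coarse.\<Omega> = fine.\<Omega>"
    using coarse_point_exists unfolding lift_set_def by blast
  then show ?thesis using fine_H_subset by (auto simp: common_def coarse.HA_Omega fine.HA_Omega)
qed

lemma common_mono:
  assumes "A \<in> coarse.\<S>" "B \<in> coarse.\<S>" "A \<subseteq> B"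
  shows "common A \<subseteq> common B"
proof -
  have "lift A \<subseteq> lift B" using assms(3) by (auto simp: lift_set_def)
  then show ?thesis
    using assms coarse.HA_mono[OF assms] fine.HA_mono[of "lift A" "lift B"] lift_in_Sigma
    unfolding common_def by blast
qed

text \<open>The coordinate projection itself splits \<open>\<phi>\<close>. On the fine side
  \<open>p t a \<phi>\<close> is a sum of vectors \<open>p' t b \<phi>\<close>, each belonging to a
  fine coordinate event contained in the lift.\<close>

lemma common_coordinate:
  assumes \<phi>: "\<phi> \<in> fine.H" and t: "t \<in> S" "a \<in> \<Gamma> t"
  shows "p t a \<phi> \<in> common {\<omega> \<in> coarse.\<Omega>. \<omega> t = a}"
    and "\<phi> - p t a \<phi> \<in> common (coarse.\<Omega> - {\<omega> \<in> coarse.\<Omega>. \<omega> t = a})"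
proof -
  let ?A = "\<lambda>a. {\<omega> \<in> coarse.\<Omega>. \<omega> t = a}"
  have \<phi>': "\<phi> \<in> coarse.H" using \<phi> fine_H_subset by blast
  have A: "?A a \<in> coarse.\<S>" if "a \<in> \<Gamma> t" for a using t that by (intro coordinate_in_Sigma_rho)
  have fine: "p t a \<phi> \<in> HA S' \<Gamma>' p' (lift (?A a))" if a: "a \<in> \<Gamma> t" for a
  proof (rule closed_csubspace_has_sum[OF _ has_sum_refined[OF t(1) a]])
    show "closed_csubspace (HA S' \<Gamma>' p' (lift (?A a)))"
      by (intro fine.closed_csubspace_HA lift_in_Sigma A a)
    fix b assume b: "b \<in> g t a"
    have tb: "t \<in> S'" "b \<in> \<Gamma>' t" using S_subset t g_subset[OF t(1) a b] by auto
    have "{\<omega>' \<in> fine.\<Omega>. \<omega>' t = b} \<subseteq> lift (?A a)" using lift_coordinate[OF t(1) a] b by auto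
    then show "p' t b \<phi> \<in> HA S' \<Gamma>' p' (lift (?A a))"
      using fine.HA_mono[OF coordinate_in_Sigma_rho[where \<Delta> = \<Gamma>', OF tb] lift_in_Sigma[OF A[OF a]]]
        fine.p_in_HA[OF \<phi> tb] by blast
  qed
  have mem: "p t a \<phi> \<in> common (?A a)" if "a \<in> \<Gamma> t" for a
    using fine[OF that] coarse.p_in_HA[OF \<phi>' t(1) that] by (simp add: common_def)
  then show "p t a \<phi> \<in> common (?A a)" using t by blast
  have C: "coarse.\<Omega> - ?A a \<in> coarse.\<S>" using A[OF t(2)] by auto
  \<comment> \<open>Drop the term at \<open>a\<close> from the resolution of the identity; every
    other term belongs to an event disjoint from \<open>?A a\<close>.\<close>
  have "((\<lambda>b. p t b \<phi>) has_sum (\<phi> - p t a \<phi>)) (\<Gamma> t - {a})"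
    by (intro has_sum_Diff coarse.has_sum_p t has_sum_finiteI) (use t in auto)
  then show "\<phi> - p t a \<phi> \<in> common (coarse.\<Omega> - ?A a)"
  proof (rule closed_csubspace_has_sum[OF closed_csubspace_common[OF C]])
    fix b assume b: "b \<in> \<Gamma> t - {a}"
    then have "?A b \<subseteq> coarse.\<Omega> - ?A a" by auto
    then show "p t b \<phi> \<in> common (coarse.\<Omega> - ?A a)"
      using common_mono[OF A C] mem b by blast
  qed
qed

lemma common_orthogonal:
  "A \<in> coarse.\<S> \<Longrightarrow> \<phi> \<in> common A \<Longrightarrow> \<psi> \<in> common (coarse.\<Omega> - A) \<Longrightarrow> cinner \<phi> \<psi> = 0"
  unfolding common_def by (blast intro: coarse.HA_orthogonal)

lemma common_UN_compl:
  assumes "\<And>i::nat. A i \<in> coarse.\<S>" "\<And>i. \<phi> \<in> common (coarse.\<Omega> - A i)"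
  shows "\<phi> \<in> common (coarse.\<Omega> - (\<Union>i. A i))"
proof -
  have sub: "A i \<subseteq> coarse.\<Omega>" for i using assms(1) coarse.sa.sets_into_space by blast
  then have "\<phi> \<in> HA S' \<Gamma>' p' (fine.\<Omega> - (\<Union>i. lift (A i)))"
    using assms by (intro fine.HA_UN_compl lift_in_Sigma) (auto simp: common_def lift_compl)
  moreover have "lift (coarse.\<Omega> - (\<Union>i. A i)) = fine.\<Omega> - (\<Union>i. lift (A i))"
    using sub by (subst lift_compl) (auto simp: lift_UN)
  ultimately show ?thesis
    using coarse.HA_UN_compl[of A \<phi>] assms by (simp add: common_def)
qed

text \<open>For a union, subtracting the orthogonal projection onto \<open>common (\<Union>i. A i)\<close> leaves a vector
  whose component in each \<open>common (A i)\<close> vanishes; no convergence argument is needed.\<close>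

lemma common_decomposition:
  assumes "A \<in> coarse.\<S>" "\<phi> \<in> fine.H"
  shows "\<exists>\<psi>\<in>common A. \<phi> - \<psi> \<in> common (coarse.\<Omega> - A)"
  using assms(1)[unfolded Sigma_rho_def] assms(2)
proof (induction arbitrary: \<phi>)
  case (Basic A)
  then show ?case using common_coordinate by blast
next
  case Empty
  then show ?case
    using closed_csubspaceD(1)[OF closed_csubspace_common[of "{}"]]
    by (intro bexI[of _ 0]) (auto simp: common_Omega)
next
  case (Compl A)
  then obtain \<psi> where \<psi>: "\<psi> \<in> common A" "\<phi> - \<psi> \<in> common (coarse.\<Omega> - A)" by blast
  have "A \<subseteq> coarse.\<Omega>"
    using Compl.hyps coarse.sa.sets_into_space by (simp add: Sigma_rho_def)
  then have "coarse.\<Omega> - (coarse.\<Omega> - A) = A" by blast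
  \<comment> \<open>For the complement the two components exchange roles.\<close>
  then show ?case using \<psi> by (intro bexI[of _ "\<phi> - \<psi>"]) auto
next
  case (Union A)
  then have A: "A i \<in> coarse.\<S>" for i by (simp add: Sigma_rho_def)
  then have U: "(\<Union>i. A i) \<in> coarse.\<S>" by auto
  note L = closed_csubspace_common[OF U]
  define \<psi> where "\<psi> = proj_onto (common (\<Union>i. A i)) \<phi>"
  have \<psi>: "\<psi> \<in> common (\<Union>i. A i)" unfolding \<psi>_def by (rule proj_onto_in[OF L])
  have "\<phi> - \<psi> \<in> common (coarse.\<Omega> - A i)" for i
  proof -
    have "\<phi> - \<psi> \<in> fine.H" using Union.prems \<psi> common_subset by (intro fine.H_simps) auto
    then obtain \<eta> where \<eta>: "\<eta> \<in> common (A i)" "\<phi> - \<psi> - \<eta> \<in> common (coarse.\<Omega> - A i)"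
      using Union.IH by blast
    have "\<eta> \<in> common (\<Union>i. A i)" using \<eta>(1) common_mono[OF A U] by blast
    \<comment> \<open>The vector \<open>\<eta>\<close> is orthogonal to
      \<open>\<phi> - \<psi>\<close> and to \<open>\<phi> - \<psi> - \<eta>\<close>, hence to
      itself.\<close>
    then have "cinner (\<phi> - \<psi>) \<eta> = 0" unfolding \<psi>_def by (rule proj_onto_orthogonal[OF L])
    moreover have "cinner \<eta> (\<phi> - \<psi> - \<eta>) = 0" using common_orthogonal[OF A \<eta>] .
    ultimately have "cinner \<eta> \<eta> = 0"
      using cinner_commute[of \<eta> "\<phi> - \<psi>"] by (simp add: cinner_diff_right)
    then show ?thesis using \<eta>(2) by (simp add: cinner_self_eq_zero)
  qed
  then have "\<phi> - \<psi> \<in> common (coarse.\<Omega> - (\<Union>i. A i))" using A by (intro common_UN_compl)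
  with \<psi> show ?case by blast
qed

text \<open>Split \<open>\<phi>\<close> by \<open>common_decomposition\<close>. The residual lies in
  both subspaces of the complementary event, so membership of \<open>\<phi>\<close> on either the
  coarse or the fine side makes it orthogonal to \<open>\<phi>\<close>; being orthogonal to
  \<open>\<psi>\<close> too, it is 0.\<close>

lemma
  assumes A: "A \<in> coarse.\<S>"
  shows HA_Int_fine_H: "HA S \<Gamma> p A \<inter> fine.H = common A"
    and HA_lift: "HA S' \<Gamma>' p' (lift A) = common A"
proof -
  have "\<phi> \<in> common A" if \<phi>: "\<phi> \<in> fine.H" and or: "\<phi> \<in> HA S \<Gamma> p A \<or> \<phi> \<in> HA S' \<Gamma>' p' (lift A)" for \<phi>
  proof -
    obtain \<psi> where \<psi>: "\<psi> \<in> common A" "\<phi> - \<psi> \<in> common (coarse.\<Omega> - A)"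
      using common_decomposition[OF A \<phi>] by blast
    have "cinner \<psi> (\<phi> - \<psi>) = 0" using common_orthogonal[OF A \<psi>] .
    moreover have "cinner \<phi> (\<phi> - \<psi>) = 0"
      using or
    proof
      assume "\<phi> \<in> HA S \<Gamma> p A"
      then show ?thesis using \<psi>(2) coarse.HA_orthogonal[OF A] by (simp add: common_def)
    next
      assume "\<phi> \<in> HA S' \<Gamma>' p' (lift A)"
      then show ?thesis
        using \<psi>(2) fine.HA_orthogonal[OF lift_in_Sigma[OF A]] coarse.sa.sets_into_space[OF A]
        by (simp add: common_def lift_compl)
    qed
    ultimately have "cinner (\<phi> - \<psi>) (\<phi> - \<psi>) = 0" by (simp add: cinner_diff_left)
    then show ?thesis using \<psi>(1) by (simp add: cinner_self_eq_zero)
  qed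
  then show "HA S \<Gamma> p A \<inter> fine.H = common A" "HA S' \<Gamma>' p' (lift A) = common A"
    using common_subset[of A] fine.HA_subset_H[of "lift A"] unfolding common_def by blast+
qed

text \<open>The component in \<open>common A\<close> leaves a residual orthogonal to all of
  \<open>HA S \<Gamma> p A\<close>, so it already is the projection of
  \<open>\<phi>\<close>.\<close>

lemma pA_maps_fine_H:
  assumes A: "A \<in> coarse.\<S>" and \<phi>: "\<phi> \<in> fine.H"
  shows "pA S \<Gamma> p A \<phi> \<in> fine.H"
proof -
  obtain \<psi> where \<psi>: "\<psi> \<in> common A" "\<phi> - \<psi> \<in> common (coarse.\<Omega> - A)"
    using common_decomposition[OF A \<phi>] by blast
  have "pA S \<Gamma> p A \<phi> = \<psi>"
    unfolding pA_def
  proof (rule proj_onto_eqI[OF coarse.closed_csubspace_HA[OF A]])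
    show "\<psi> \<in> HA S \<Gamma> p A" using \<psi>(1) by (simp add: common_def)
    fix s assume "s \<in> HA S \<Gamma> p A"
    then have "cinner s (\<phi> - \<psi>) = 0"
      using \<psi>(2) coarse.HA_orthogonal[OF A] by (simp add: common_def)
    then show "cinner (\<phi> - \<psi>) s = 0" using cinner_commute[of "\<phi> - \<psi>" s] by simp
  qed
  then show ?thesis using \<psi>(1) common_subset by blast
qed

end

text \<open>Invariance says \<open>P Q = Q P Q\<close>, whose right side is self-adjoint; taking
  adjoints gives \<open>Q P = Q P Q\<close> as well.\<close>

lemma is_proj_commute_if_invariant:
  fixes P Q :: "'a::complex_inner \<Rightarrow> 'a"
  assumes P: "is_proj P" and Q: "is_proj Q" and inv: "\<And>x. x \<in> range Q \<Longrightarrow> P x \<in> range Q"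
  shows "P \<circ> Q = Q \<circ> P"
proof
  fix x
  have QPQ: "Q (P (Q y)) = P (Q y)" for y using inv[of "Q y"] range_is_proj[OF Q] by auto
  define d where "d = P (Q x) - Q (P x)"
  have "cinner (P (Q x)) y = cinner (Q (P x)) y" for y
  proof -
    have "cinner (P (Q x)) y = cinner (Q (P (Q x))) y" by (simp add: QPQ)
    also have "\<dots> = cinner x (Q (P (Q y)))" by (simp add: is_projD(3)[OF P] is_projD(3)[OF Q])
    also have "\<dots> = cinner (Q (P x)) y" by (simp add: QPQ is_projD(3)[OF P] is_projD(3)[OF Q])
    finally show ?thesis .
  qed
  then have "cinner d d = 0" by (simp add: d_def cinner_diff_left)
  then show "(P \<circ> Q) x = (Q \<circ> P) x" by (simp add: cinner_self_eq_zero d_def)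
qed

text \<open>Commutation puts the values of the product in both ranges; the residual is orthogonal to
  vectors fixed by both projections.\<close>

lemma proj_onto_Int_eq_comp:
  fixes S :: "'h::chilbert_space set"
  assumes S: "closed_csubspace S" and R: "closed_csubspace R"
    and comm: "proj_onto S \<circ> proj_onto R = proj_onto R \<circ> proj_onto S"
  shows "proj_onto (S \<inter> R) = proj_onto S \<circ> proj_onto R"
proof
  fix x
  have c: "proj_onto S (proj_onto R x) = proj_onto R (proj_onto S x)" using comm by (metis comp_apply)
  show "proj_onto (S \<inter> R) x = (proj_onto S \<circ> proj_onto R) x"
  proof (rule proj_onto_eqI[OF closed_csubspace_Int[OF S R]])
    show "(proj_onto S \<circ> proj_onto R) x \<in> S \<inter> R"
      using proj_onto_in[OF S, of "proj_onto R x"] proj_onto_in[OF R, of "proj_onto S x"] c by simp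
    fix s assume "s \<in> S \<inter> R"
    then have "proj_onto S s = s" "proj_onto R s = s" using proj_onto_id S R by auto
    then show "cinner (x - (proj_onto S \<circ> proj_onto R) x) s = 0"
      by (simp add: cinner_diff_left is_projD(3)[OF is_proj_proj_onto[OF S]]
          is_projD(3)[OF is_proj_proj_onto[OF R]])
  qed
qed

theorem theorem8:
  fixes p :: "'t \<Rightarrow> 'c \<Rightarrow> 'h::chilbert_space \<Rightarrow> 'h"
    and p' :: "'t \<Rightarrow> 'd \<Rightarrow> 'h \<Rightarrow> 'h"
    and S S' :: "'t set" and \<Gamma> :: "'t \<Rightarrow> 'c set" and \<Gamma>' :: "'t \<Rightarrow> 'd set"
    and g :: "'t \<Rightarrow> 'c \<Rightarrow> 'd set" and A :: "('t \<Rightarrow> 'c) set"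
  assumes "proj_family S \<Gamma> p"
    and "refinement S \<Gamma> p S' \<Gamma>' p' g"
    and "A \<in> Sigma_rho S \<Gamma>"
  shows "lift_set S S' \<Gamma>' g A \<in> Sigma_rho S' \<Gamma>'
    \<and> pA S' \<Gamma>' p' (lift_set S S' \<Gamma>' g A) = pA S \<Gamma> p A \<circ> prho S' \<Gamma>' p'
    \<and> pA S' \<Gamma>' p' (lift_set S S' \<Gamma>' g A) = prho S' \<Gamma>' p' \<circ> pA S \<Gamma> p A
    \<and> pA S' \<Gamma>' p' (lift_set S S' \<Gamma>' g A) = pmeet {pA S \<Gamma> p A, prho S' \<Gamma>' p'}
    \<and> pA S \<Gamma> p A \<circ> prho S' \<Gamma>' p' = prho S' \<Gamma>' p' \<circ> pA S \<Gamma> p A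
    \<and> HA S' \<Gamma>' p' (lift_set S S' \<Gamma>' g A) = HA S \<Gamma> p A \<inter> Hrho S' \<Gamma>' p'"
proof -
  interpret refined_family S \<Gamma> p S' \<Gamma>' p' g
    using assms by unfold_locales (auto simp: refinement_def)
  note A = assms(3)
  have cA: "closed_csubspace (HA S \<Gamma> p A)" by (rule coarse.closed_csubspace_HA[OF A])
  note cH = fine.closed_csubspace_H
  \<comment> \<open>Both sides equal \<open>common A\<close>.\<close>
  have HA: "HA S' \<Gamma>' p' (lift A) = HA S \<Gamma> p A \<inter> fine.H"
    using HA_Int_fine_H[OF A] HA_lift[OF A] by simp
  have comm: "pA S \<Gamma> p A \<circ> prho S' \<Gamma>' p' = prho S' \<Gamma>' p' \<circ> pA S \<Gamma> p A"
  proof (rule is_proj_commute_if_invariant)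
    show "is_proj (pA S \<Gamma> p A)" "is_proj (prho S' \<Gamma>' p')"
      unfolding pA_def prho_def by (rule is_proj_proj_onto, fact)+
    show "pA S \<Gamma> p A x \<in> range (prho S' \<Gamma>' p')" if "x \<in> range (prho S' \<Gamma>' p')" for x
      using that pA_maps_fine_H[OF A] unfolding prho_def range_proj_onto[OF cH] by blast
  qed
  have eq: "pA S' \<Gamma>' p' (lift A) = pA S \<Gamma> p A \<circ> prho S' \<Gamma>' p'"
    using proj_onto_Int_eq_comp[OF cA cH] comm by (simp add: pA_def prho_def HA)
  \<comment> \<open>The lattice meet projects onto the intersection of the two ranges, the same
    subspace as in \<open>HA\<close>.\<close>
  have "pmeet {pA S \<Gamma> p A, prho S' \<Gamma>' p'} = pA S' \<Gamma>' p' (lift A)"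
    by (simp add: pmeet_def pA_def prho_def HA range_proj_onto[OF cA] range_proj_onto[OF cH])
  with HA comm eq show ?thesis using lift_in_Sigma[OF A] by simp
qed

end
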